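(* Let $r\ge2$, let $a_1,\dots,a_r$ be pairwise distinct real numbers, and let $(\mathbf n^{(N)})_{N\in\mathbb N}$ be a path-like sequence of multi-indices in $\mathbb N^r$ with limiting proportions $q_1,\dots,q_r\in(0,1)$ (see context). Let $\nu_N$ be the zero probability distribution of the rescaled multiple Hermite polynomial $$x\mapsto H_N^{(\sqrt N a_1,\dots,\sqrt N a_r)}\big(\sqrt N x\big).$$ Then $\nu_N$ converges weakly as $N\to\infty$ towards $$\mu_{\mathrm{SC}}\boxplus\Big(\sum_{j=1}^r q_j\delta_{a_j}\Big).$$
   Context: $\mathbb N=\{0,1,2,\dots\}$. Path-like sequence: multi-indices $\mathbf n^{(N)}=(n_1^{(N)},\dots,n_r^{(N)})\in\mathbb N^r$, $N\in\mathbb N$, such that (a) $\sum_{i=1}^r n_i^{(N)}=N$ for every $N$; (b) $n_i^{(N+1)}\ge n_i^{(N)}$ for every $N$ and $1\le i\le r$; (c) there is $R\in\mathbb N$ such that $n_i^{(N+R)}\ge n_i^{(N)}+1$ for every $N$ and $1\le i\le r$; (d) there are $q_1,\dots,q_r\in(0,1)$ with $\lim_{N\to\infty}n_i^{(N)}/N=q_i$ for $1\le i\le r$. Multiple Hermite polynomial: for pairwise distinct reals $b_1,\dots,b_r$, $H_N^{(b_1,\dots,b_r)}$ is the unique monic polynomial of degree $N$ such that for every $1\le j\le r$, $$\int_{\mathbb R}x^kH_N^{(b_1,\dots,b_r)}(x)\,e^{b_jx}e^{-x^2/2}\,\mathrm dx=0,\qquad 0\le k\le n_j^{(N)}-1$$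 (for these weights existence and uniqueness hold for every multi-index). The zero probability distribution of a polynomial of degree $N$ with complex zeros $z_1,\dots,z_N$ (with multiplicity) is $\frac1N\sum_{i=1}^N\delta_{z_i}$. $\mu_{\mathrm{SC}}(\mathrm dx)=\frac1{2\pi}\sqrt{4-x^2}\,\mathbf 1_{[-2,2]}(x)\,\mathrm dx$ is the semi-circle distribution. Free additive convolution: for a compactly supported probability measure $\lambda$ on $\mathbb R$, let $G_\lambda(z)=\int\frac{\lambda(\mathrm dx)}{z-x}=\sum_{k\ge0}\big(\int x^k\lambda(\mathrm dx)\big)z^{-k-1}$, let $K_\lambda$ be its inverse for composition of formal series, and $R_\lambda(z)=K_\lambda(z)-\frac1z$. For compactly supported probability measures $\lambda,\eta$ on $\mathbb R$, $\lambda\boxplus\eta$ is the unique compactly supported probability measure on $\mathbb R$ with $R_{\lambda\boxplus\eta}=R_\lambda+R_\eta$. *)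

theory Defs
  imports
    "HOL-Probability.Probability"
    "HOL-Computational_Algebra.Computational_Algebra"
begin

unbundle fps_syntax

(* Multi-indices in \<nat>^r are functions nat \<Rightarrow> nat, only the coordinates i < r being relevant;
   n N is the N-th multi-index of the sequence. *)
definition path_like :: "nat \<Rightarrow> (nat \<Rightarrow> nat \<Rightarrow> nat) \<Rightarrow> (nat \<Rightarrow> real) \<Rightarrow> bool" where
  "path_like r n q \<longleftrightarrow>
     (\<forall>N. (\<Sum>i<r. n N i) = N) \<and>
     (\<forall>N. \<forall>i<r. n (N + 1) i \<ge> n N i) \<and>
     (\<exists>R. \<forall>N. \<forall>i<r. n (N + R) i \<ge> n N i + 1) \<and>
     (\<forall>i<r. q i \<in> {0<..<1} \<and> (\<lambda>N. real (n N i) / real N) \<longlonglongrightarrow> q i)"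

definition is_multiple_hermite :: "nat \<Rightarrow> (nat \<Rightarrow> nat) \<Rightarrow> (nat \<Rightarrow> real) \<Rightarrow> real poly \<Rightarrow> bool" where
  "is_multiple_hermite r n b p \<longleftrightarrow>
     lead_coeff p = 1 \<and> degree p = (\<Sum>i<r. n i) \<and>
     (\<forall>j<r. \<forall>k<n j.
        (LINT x|lborel. x ^ k * poly p x * exp (b j * x) * exp (- x\<^sup>2 / 2)) = 0)"

definition multiple_hermite :: "nat \<Rightarrow> (nat \<Rightarrow> nat) \<Rightarrow> (nat \<Rightarrow> real) \<Rightarrow> real poly" where
  "multiple_hermite r n b = (THE p. is_multiple_hermite r n b p)"

(* pmf_of_multiset gives a zero z the mass (multiplicity of z) / (number of zeros); the value is
   unspecified for a polynomial without zeros. *)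
definition zero_distribution :: "complex poly \<Rightarrow> complex measure" where
  "zero_distribution p = distr (measure_pmf (pmf_of_multiset (proots p))) borel (\<lambda>z. z)"

(* Zeros are complex a priori, so weak convergence is needed for measures on the complex plane;
   the library's weak_conv_m, stated through distribution functions, covers the real line only. *)
definition converges_weakly :: "(nat \<Rightarrow> 'a::topological_space measure) \<Rightarrow> 'a measure \<Rightarrow> bool" where
  "converges_weakly M L \<longleftrightarrow>
     (\<forall>f::'a \<Rightarrow> real. continuous_on UNIV f \<and> bounded (range f) \<longrightarrow>
        (\<lambda>n. integral\<^sup>L (M n) f) \<longlonglongrightarrow> integral\<^sup>L L f)"

definition semicircle :: "real measure" where
  "semicircle = density lborel
     (\<lambda>x. ennreal (1 / (2 * pi) * sqrt (4 - x\<^sup>2) * indicator {-2..2} x))"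

(* The sum of q j times the Dirac mass at a j over j < r, as the image under a of the measure on
   the index set with point masses q j. *)
definition weighted_diracs :: "nat \<Rightarrow> (nat \<Rightarrow> real) \<Rightarrow> (nat \<Rightarrow> real) \<Rightarrow> real measure" where
  "weighted_diracs r q a = distr (point_measure {..<r} (\<lambda>j. ennreal (q j))) borel a"

definition compactly_supported_prob :: "real measure \<Rightarrow> bool" where
  "compactly_supported_prob M \<longleftrightarrow>
     prob_space M \<and> sets M = sets borel \<and> (\<exists>K. compact K \<and> emeasure M (- K) = 0)"

(* G(z), a series in 1/z, is represented as a power series in w = 1/z: the coefficient of
   w^(k+1) is the k-th moment. *)
definition cauchy_series :: "real measure \<Rightarrow> real fps" where
  "cauchy_series M = fps_X * Abs_fps (\<lambda>k. LINT x|M. x ^ k)"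

(* G(K(z)) = z says that 1/K is the compositional inverse of the power series cauchy_series M in
   w = 1/z. *)
definition K_series :: "real measure \<Rightarrow> real fls" where
  "K_series M = inverse (fps_to_fls (fps_inv (cauchy_series M)))"

lemma K_series_right_inverse:
  assumes "prob_space M"
  shows "fps_compose (cauchy_series M) (fls_regpart (inverse (K_series M))) = fps_X"
  unfolding K_series_def
  using assms by (simp add: fps_inv_right cauchy_series_def prob_space.prob_space)

(* K(G(z)) = z, where fls_X_inv in the variable w = 1/z stands for z. *)
lemma K_series_left_inverse:
  assumes "prob_space M"
  shows "fls_compose_fps (K_series M) (cauchy_series M) = fls_X_inv"
proof -
  have 0: "cauchy_series M $ 0 = 0" and 1: "cauchy_series M $ 1 \<noteq> 0"
    using assms by (simp_all add: cauchy_series_def prob_space.prob_space)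
  then have "cauchy_series M \<noteq> 0"
    by auto
  with 0 1 show ?thesis
    by (simp add: K_series_def fls_compose_fps_inverse fps_inv fls_inverse_X)
qed

definition R_transform :: "real measure \<Rightarrow> real fls" where
  "R_transform M = K_series M - 1 / fls_X"

definition free_convolution :: "real measure \<Rightarrow> real measure \<Rightarrow> real measure"
    (infixl "\<boxplus>" 65) where
  "M \<boxplus> L = (THE P. compactly_supported_prob P \<and>
                R_transform P = R_transform M + R_transform L)"

end

theory Submission
  imports Defs
begin

text \<open>Write \<open>D\<close> for differentiation and \<open>heat s p\<close> for \<open>exp (s D\<^sup>2 / 2) p\<close>, a polynomial for every real \<open>s\<close>. Averaging a
polynomial against a Gaussian of mean \<open>b\<close> and variance 1 evaluates \<open>heat 1 p\<close> at \<open>b\<close>, so the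
orthogonality relations at \<open>b j\<close> say that \<open>heat 1 p\<close> vanishes at \<open>b j\<close> to order \<open>n j\<close>. Hence the
multiple Hermite polynomial is \<open>heat (-1)\<close> applied to the product of the \<open>(x - b j) ^ n j\<close>
(\<open>multiple_hermite_eq_heat\<close>), and after rescaling it is, up to a constant factor,
\<open>Q = heat (-1/N) P\<close>, where \<open>P\<close> is the product of the \<open>(x - a j) ^ n j\<close>.

The zeros of \<open>Q\<close> are real and lie in a compact set which does not depend on \<open>N\<close>
(\<open>heat_root_poly\<close>). They are real because \<open>heat (-1/N)\<close> turns multiplication by \<open>x - a\<close> into the
operator \<open>x - a - D/N\<close>, which preserves real-rootedness. They are bounded because \<open>heat (-1/N)\<close> of a
polynomial of degree at most \<open>N\<close> with nonnegative coefficients is positive on \<open>[2, \<infinity>)\<close>: there the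
rescaled Hermite polynomials of degree at most \<open>N\<close> are positive.

By Helly's theorem it is therefore enough to identify the weak limits of subsequences. Let \<open>G\<close> be the
Cauchy transform of such a limit, as a power series in \<open>w = 1/z\<close>. Applying \<open>heat (-1/N)\<close> to
\<open>\<Prod>(x - a j) P' = \<Sum> n j \<Prod>\<^sub>i\<^sub>\<noteq>\<^sub>j (x - a i) P\<close> gives a linear differential equation for \<open>Q\<close>, in which \<open>x\<close> is
replaced by \<open>x - D/N\<close>. Divide it by \<open>N Q\<close>. As \<open>Q'/(N Q)\<close> is the Cauchy transform of the zeros, \<open>D/N\<close>
acts in the limit as multiplication by \<open>G\<close>, the derivatives of quotients being of order \<open>1/N\<close>; this
gives \<open>\<Prod>(z - G - a j) G = \<Sum> q j \<Prod>\<^sub>i\<^sub>\<noteq>\<^sub>j (z - G - a i)\<close> (\<open>moment_series_equation\<close>), that is,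
\<open>G(z) = \<Sum> q j / (z - G(z) - a j)\<close>. So \<open>G\<close> is the Cauchy transform of the sum of the \<open>q j \<delta>\<^sub>a\<^sub>j\<close>
evaluated at \<open>z - G(z)\<close> (\<open>subordination\<close>), and passing to inverse functions, the R-transform of the
limit exceeds that of this sum by the identity function, which is the R-transform of the semicircle
distribution. Compactly supported measures are determined by their moments, so all subsequences have
the same limit, and this limit is the free convolution; its existence is obtained here as well.\<close>

section \<open>The heat operator on polynomials\<close>

text \<open>\<open>heat s\<close> is \<open>exp (s D\<^sup>2 / 2)\<close>. Since \<open>exp (s D\<^sup>2 / 2) x = (x + s D) exp (s D\<^sup>2 / 2)\<close> as operators, it is given by a Horner scheme
in which multiplication by \<open>x\<close> is replaced by the operator \<open>x + s D\<close>; this form makes every property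
below an induction on the coefficients.\<close>
definition heat :: "real \<Rightarrow> real poly \<Rightarrow> real poly" where
  "heat s p = fold_coeffs (\<lambda>c f. [:c:] + pCons 0 f + smult s (pderiv f)) p 0"

lemma heat_0 [simp]: "heat s 0 = 0"
  by (simp add: heat_def)

lemma heat_pCons: "heat s (pCons c p) = [:c:] + pCons 0 (heat s p) + smult s (pderiv (heat s p))"
  by (cases "p = 0 \<and> c = 0") (auto simp: heat_def)

lemma heat_const [simp]: "heat s [:c:] = [:c:]"
  by (simp add: heat_pCons)

lemma heat_1 [simp]: "heat s 1 = 1"
  by (simp add: one_pCons)

lemma heat_add: "heat s (p + q) = heat s p + heat s q"
proof (induction p arbitrary: q)
  case (pCons c p)
  obtain d q' where q: "q = pCons d q'" by (cases q)
  have "pCons c p + q = pCons (c + d) (p + q')" by (simp add: q)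
  moreover have "[:c + d:] = [:c:] + [:d:]" by simp
  moreover have "pCons 0 (f + g) = pCons 0 f + pCons 0 g" for f g :: "real poly" by simp
  ultimately show ?case
    unfolding q by (simp only: heat_pCons pCons.IH pderiv_add smult_add_right add_ac)
qed simp

lemma heat_smult: "heat s (smult a p) = smult a (heat s p)"
proof (induction p)
  case (pCons c p)
  show ?case
    using pCons.IH by (simp add: heat_pCons pderiv_smult smult_add_right mult.commute)
qed simp

lemma heat_sum: "heat s (\<Sum>i\<in>A. f i) = (\<Sum>i\<in>A. heat s (f i))"
  by (induction A rule: infinite_finite_induct) (simp_all add: heat_add)

lemma heat_X_mult: "heat s (pCons 0 p) = pCons 0 (heat s p) + smult s (pderiv (heat s p))"
  by (simp add: heat_pCons)

lemma heat_linear_mult: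
  "heat s ([:b, e:] * p) = [:b, e:] * heat s p + smult (s * e) (pderiv (heat s p))"
proof -
  have "[:b, e:] * p = smult b p + smult e (pCons 0 p)" for p :: "real poly"
    by simp
  then show ?thesis
    by (simp only: heat_add heat_smult heat_X_mult) (simp add: smult_add_right mult.commute)
qed

lemma heat_pderiv: "heat s (pderiv p) = pderiv (heat s p)"
proof (induction p)
  case (pCons c p)
  then show ?case
    by (simp add: heat_pCons heat_add heat_X_mult pderiv_add pderiv_pCons pderiv_smult algebra_simps)
qed simp

lemma heat_heat_inverse: "heat (- s) (heat s p) = p"
proof (induction p)
  case (pCons c p)
  then show ?case
    by (simp add: heat_pCons heat_add heat_smult heat_pderiv)
qed simp

text \<open>The chain rule \<open>D (p \<circ> l) = e (D p) \<circ> l\<close> for \<open>l x = b + e x\<close> multiplies the time \<open>s\<close> by \<open>e\<^sup>2\<close>. With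
\<open>e = \<plusminus>1\<close> this is invariance under translations and reflections, with \<open>e = \<surd>N\<close> it produces the
time \<open>-1/N\<close> of the rescaled polynomials.\<close>
lemma heat_pcompose_affine:
  "heat s (pcompose p [:b, e:]) = pcompose (heat (s * e\<^sup>2) p) [:b, e:]"
proof (induction p)
  case (pCons c p)
  have "pderiv (pcompose f [:b, e:]) = smult e (pcompose (pderiv f) [:b, e:])" for f
    by (simp add: pderiv_pcompose pderiv_pCons)
  then show ?case
    unfolding pcompose_pCons heat_add heat_linear_mult pCons.IH
    by (simp add: heat_pCons pcompose_add pcompose_smult pcompose_pCons power2_eq_square mult_ac)
qed simp

lemma coeff_heat_top:
  "degree p \<le> n \<Longrightarrow> degree (heat s p) \<le> n \<and> coeff (heat s p) n = coeff p n"
proof (induction p arbitrary: n)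
  case (pCons c p)
  show ?case
  proof (cases "p = 0")
    case False
    then obtain m where n: "n = Suc m" and m: "degree p \<le> m"
      using pCons.prems by (cases n) auto
    have IH: "degree (heat s p) \<le> m" "coeff (heat s p) m = coeff p m"
      using pCons.IH[OF m] by auto
    have "degree (pderiv (heat s p)) \<le> m"
      using IH(1) by (simp add: degree_pderiv)
    then have "degree ([:c:] + pCons 0 (heat s p) + smult s (pderiv (heat s p))) \<le> Suc m"
      using IH(1) by (intro degree_add_le) (auto intro: order.trans[OF degree_smult_le] degree_pCons_le[THEN order.trans])
    moreover have "coeff (pderiv (heat s p)) (Suc m) = 0"
      using \<open>degree (pderiv (heat s p)) \<le> m\<close> by (intro coeff_eq_0) simp
    ultimately show ?thesis
      using IH by (simp add: heat_pCons n)
  qed (use pCons.prems in \<open>auto simp: heat_pCons\<close>)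
qed simp

lemma degree_heat [simp]: "degree (heat s p) = degree p"
proof (rule antisym)
  show "degree (heat s p) \<le> degree p"
    using coeff_heat_top by blast
  show "degree p \<le> degree (heat s p)"
    using coeff_heat_top[of "heat s p" "degree (heat s p)" "- s"] by (simp add: heat_heat_inverse)
qed

lemma lead_coeff_heat [simp]: "coeff (heat s p) (degree p) = lead_coeff p"
  using coeff_heat_top[of p "degree p" s] by simp

section \<open>Gaussian orthogonality and multiple Hermite polynomials\<close>

lemma integrable_std_normal_poly: "integrable lborel (\<lambda>x. std_normal_density x * poly p x)"
proof (rule Bochner_Integration.integrable_cong[THEN iffD1])
  show "integrable lborel (\<lambda>x. \<Sum>i\<le>degree p. coeff p i * (std_normal_density x * x ^ i))"
    by (intro Bochner_Integration.integrable_sum integrable_mult_right integrable_std_normal_moment)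
qed (auto simp: poly_altdef sum_distrib_left mult_ac)

lemma std_normal_expectation_add:
  "(LINT x|lborel. std_normal_density x * poly (p + q) x)
     = (LINT x|lborel. std_normal_density x * poly p x) + (LINT x|lborel. std_normal_density x * poly q x)"
  by (simp add: distrib_left Bochner_Integration.integral_add integrable_std_normal_poly)

lemma std_normal_moment_Suc:
  "(LINT x|lborel. std_normal_density x * x ^ Suc (Suc k)) = real (Suc k) * (LINT x|lborel. std_normal_density x * x ^ k)"
proof (cases "even k")
  case True
  then obtain j where k: "k = 2 * j" by blast
  have eq: "Suc (Suc k) = 2 * Suc j" by (simp add: k)
  have num: "fact (2 * Suc j) = real (2 * j + 2) * (real (2 * j + 1) * fact (2 * j))"
    by simp
  have den: "2 ^ Suc j * fact (Suc j) = real (2 * j + 2) * (2 ^ j * fact j)"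
    by simp
  have fact_Suc: "fact (2 * Suc j) / (2 ^ Suc j * fact (Suc j))
      = real (2 * j + 1) * (fact (2 * j) / (2 ^ j * fact j))"
    unfolding num den by (subst mult_divide_mult_cancel_left) simp_all
  have "real (Suc k) = real (2 * j + 1)" by (simp add: k)
  then show ?thesis
    by (simp only: eq integral_std_normal_moment_even fact_Suc) (simp only: k integral_std_normal_moment_even)
next
  case False
  then obtain j where k: "k = 2 * j + 1" using oddE by blast
  have "Suc (Suc k) = 2 * Suc j + 1" by (simp add: k)
  then show ?thesis
    using integral_std_normal_moment_odd[of "Suc j"] integral_std_normal_moment_odd[of j]
    by (simp add: k)
qed

lemma std_normal_integration_by_parts:
  "(LINT x|lborel. std_normal_density x * poly (pCons 0 p) x)
     = (LINT x|lborel. std_normal_density x * poly (pderiv p) x)"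
proof -
  have scale: "(LINT x|lborel. std_normal_density x * (c * f x))
      = c * (LINT x|lborel. std_normal_density x * f x)" for c f
    by (subst integral_mult_right_zero[symmetric]) (simp add: mult_ac)
  have mono: "(LINT x|lborel. std_normal_density x * poly (pCons 0 (monom c k)) x)
      = (LINT x|lborel. std_normal_density x * poly (pderiv (monom c k)) x)" for c k
  proof -
    have "poly (pCons 0 (monom c k)) x = c * x ^ Suc k" for x
      by (simp add: poly_monom)
    moreover have "poly (pderiv (monom c k)) x = (c * k) * x ^ (k - 1)" for x
      by (simp add: pderiv_monom poly_monom mult_ac)
    moreover have "(LINT x|lborel. std_normal_density x * x ^ Suc k)
        = real k * (LINT x|lborel. std_normal_density x * x ^ (k - 1))"
      using integral_std_normal_moment_odd[of 0] std_normal_moment_Suc[of "k - 1"] by (cases k) simp_all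
    ultimately show ?thesis
      by (simp only: scale mult.assoc)
  qed
  define L where "L p = (LINT x|lborel. std_normal_density x * poly p x)" for p
  have L_sum: "L (\<Sum>i\<in>A. f i) = (\<Sum>i\<in>A. L (f i))" for A :: "nat set" and f
    by (induction A rule: infinite_finite_induct) (auto simp: L_def std_normal_expectation_add simp del: poly_add)
  have 1: "pCons 0 (\<Sum>i\<in>A. f i) = (\<Sum>i\<in>A. pCons (0::real) (f i))" for A :: "nat set" and f
    using sum_distrib_left[of "[:0, 1:]" f A] by simp
  have 2: "pderiv (\<Sum>i\<in>A. f i) = (\<Sum>i\<in>A. pderiv (f i :: real poly))" for A :: "nat set" and f
    using higher_pderiv_sum[of 1] by simp
  have "p = (\<Sum>i\<le>degree p. monom (coeff p i) i)"
    by (simp add: poly_as_sum_of_monoms)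
  then have "L (pCons 0 p) = L (pderiv p)"
  proof -
    have "L (pCons 0 p) = L (pCons 0 (\<Sum>i\<le>degree p. monom (coeff p i) i))" using \<open>p = _\<close> by simp
    also have "\<dots> = L (pderiv (\<Sum>i\<le>degree p. monom (coeff p i) i))"
      unfolding 1 2 L_sum unfolding L_def mono ..
    also have "\<dots> = L (pderiv p)" using \<open>p = _\<close> by simp
    finally show ?thesis .
  qed
  then show ?thesis
    by (simp add: L_def)
qed


text \<open>Both sides send \<open>x p\<close> to the value for \<open>D p\<close>: the left side by integration by parts, the right side
because \<open>(x + D)\<close> acts at the point 0 as \<open>D\<close>, which commutes with \<open>heat 1\<close>.\<close>
lemma std_normal_expectation_poly:
  "(LINT x|lborel. std_normal_density x * poly p x) = poly (heat 1 p) 0"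
proof (induction "degree p" arbitrary: p rule: less_induct)
  case less
  obtain c q where p: "p = pCons c q" by (cases p)
  show ?case
  proof (cases "degree p = 0")
    case True
    then obtain c where "p = [:c:]" by (rule degree_eq_zeroE)
    then show ?thesis
      using integral_std_normal_moment_even[of 0] by simp
  next
    case False
    then have "degree (pderiv q) < degree p"
      by (auto simp: p degree_pderiv split: if_splits)
    note IH = less[OF this]
    have "(LINT x|lborel. std_normal_density x * poly p x)
        = (LINT x|lborel. std_normal_density x * poly [:c:] x)
          + (LINT x|lborel. std_normal_density x * poly (pCons 0 q) x)"
      by (subst std_normal_expectation_add[symmetric]) (simp add: p)
    also have "\<dots> = c + poly (heat 1 (pderiv q)) 0"
      using integral_std_normal_moment_even[of 0]
      by (simp only: std_normal_integration_by_parts IH) simp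
    finally show ?thesis
      by (simp add: p heat_pCons heat_pderiv)
  qed
qed

text \<open>Completing the square makes the weight \<open>exp (b x - x\<^sup>2 / 2)\<close> a Gaussian of mean \<open>b\<close>, and \<open>heat 1\<close> commutes with
the translation by \<open>b\<close>.\<close>
lemma gaussian_integral_poly:
  "(LINT x|lborel. poly p x * exp (b * x) * exp (- x\<^sup>2 / 2))
     = sqrt (2 * pi) * exp (b\<^sup>2 / 2) * poly (heat 1 p) b"
proof -
  have "(LINT x|lborel. poly p x * exp (b * x) * exp (- x\<^sup>2 / 2))
      = (LINT x|lborel. poly p (b + x) * exp (b * (b + x)) * exp (- (b + x)\<^sup>2 / 2))"
    using lborel_integral_real_affine[of 1 "\<lambda>x. poly p x * exp (b * x) * exp (- x\<^sup>2 / 2)" b] by simp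
  also have "\<dots> = (LINT x|lborel. sqrt (2 * pi) * exp (b\<^sup>2 / 2) * (std_normal_density x * poly (pcompose p [:b, 1:]) x))"
  proof (rule Bochner_Integration.integral_cong)
    fix x :: real
    have "exp (b * (b + x)) * exp (- (b + x)\<^sup>2 / 2) = exp (b\<^sup>2 / 2) * exp (- x\<^sup>2 / 2)"
      unfolding exp_add[symmetric] by (simp add: power2_eq_square field_simps)
    then show "poly p (b + x) * exp (b * (b + x)) * exp (- (b + x)\<^sup>2 / 2)
        = sqrt (2 * pi) * exp (b\<^sup>2 / 2) * (std_normal_density x * poly (pcompose p [:b, 1:]) x)"
      by (simp add: std_normal_density_def poly_pcompose)
  qed simp
  also have "\<dots> = sqrt (2 * pi) * exp (b\<^sup>2 / 2) * poly (heat 1 p) b"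
    using heat_pcompose_affine[of 1 p b 1]
    by (simp only: integral_mult_right_zero std_normal_expectation_poly) (simp add: poly_pcompose)
  finally show ?thesis .
qed

text \<open>Each factor \<open>x\<close> becomes an operator \<open>x + D\<close>, and evaluation at a zero \<open>b\<close> of order \<open>m\<close> sees only the
\<open>m\<close> differentiations.\<close>
lemma poly_heat_monom_mult:
  assumes "heat 1 p = [:- b, 1:] ^ m * g"
  shows "poly (heat 1 (monom 1 m * p)) b = fact m * poly g b"
  using assms
proof (induction m arbitrary: p g)
  case 0
  then show ?case by (simp add: monom_0)
next
  case (Suc m)
  \<comment> \<open>the cofactor left after one operator \<open>x + D\<close> has lowered the order of the zero by one\<close>
  define h where "h = smult (of_nat (Suc m)) g + [:- b, 1:] * ([:0, 1:] * g + pderiv g)"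
  have "heat 1 (pCons 0 p) = [:0, 1:] * heat 1 p + pderiv (heat 1 p)"
    by (simp add: heat_X_mult)
  also have "\<dots> = [:- b, 1:] ^ m * h"
  proof -
    have "pderiv ([:- b, 1:] ^ Suc m * g) = [:- b, 1:] ^ Suc m * pderiv g + g * (smult (of_nat (Suc m)) ([:- b, 1:] ^ m))"
      by (simp only: pderiv_mult pderiv_power_Suc) (simp add: pderiv_pCons)
    then show ?thesis
      unfolding Suc.prems h_def by (simp add: algebra_simps smult_add_right del: mult_pCons_left mult_pCons_right)
  qed
  finally have "poly (heat 1 (monom 1 m * pCons 0 p)) b = fact m * poly h b"
    by (rule Suc.IH)
  moreover have "monom 1 m * pCons 0 p = monom 1 (Suc m) * p"
    by (simp add: monom_Suc)
  ultimately show ?case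
    by (simp add: h_def mult_ac)
qed

text \<open>The orthogonality relations at \<open>b\<close> up to order \<open>m\<close> form a triangular system for the Taylor
coefficients of \<open>heat 1 p\<close> at \<open>b\<close>.\<close>
lemma linear_power_dvd_heat_iff:
  "[:- b, 1:] ^ m dvd heat 1 p \<longleftrightarrow> (\<forall>k<m. poly (heat 1 (monom 1 k * p)) b = 0)"
proof (induction m)
  case (Suc m)
  show ?case
  proof (cases "[:- b, 1:] ^ m dvd heat 1 p")
    case True
    then obtain g where g: "heat 1 p = [:- b, 1:] ^ m * g" by blast
    have "[:- b, 1:] ^ Suc m dvd heat 1 p \<longleftrightarrow> [:- b, 1:] dvd g"
      unfolding g power_Suc2 by (subst dvd_mult_cancel_left) (simp add: pCons_eq_0_iff)
    also have "\<dots> \<longleftrightarrow> poly (heat 1 (monom 1 m * p)) b = 0"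
      unfolding poly_heat_monom_mult[OF g] by (simp add: poly_eq_0_iff_dvd)
    finally show ?thesis
      using True Suc.IH by (auto simp: less_Suc_eq)
  next
    case False
    then have "\<not> [:- b, 1:] ^ Suc m dvd heat 1 p"
      by (meson power_le_dvd le_SucI le_refl)
    then show ?thesis
      using Suc.IH False by (auto simp: less_Suc_eq simp del: power_Suc)
  qed
qed simp

lemma prod_linear_power_dvd_iff:
  fixes b :: "nat \<Rightarrow> real"
  assumes "inj_on b A" "finite A"
  shows "(\<Prod>j\<in>A. [:- b j, 1:] ^ m j) dvd p \<longleftrightarrow> (\<forall>j\<in>A. [:- b j, 1:] ^ m j dvd p)"
proof
  assume *: "\<forall>j\<in>A. [:- b j, 1:] ^ m j dvd p"
  show "(\<Prod>j\<in>A. [:- b j, 1:] ^ m j) dvd p"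
    using assms(2,1) *
  proof (induction A rule: finite_induct)
    case (insert i A)
    then obtain g where g: "p = (\<Prod>j\<in>A. [:- b j, 1:] ^ m j) * g"
    proof -
      have "inj_on b A" "\<forall>j\<in>A. [:- b j, 1:] ^ m j dvd p"
        using insert.prems by (auto intro: inj_on_subset)
      from insert.IH[OF this] show ?thesis
        using that by (rule dvdE)
    qed
    define P where "P = (\<Prod>j\<in>A. [:- b j, 1:] ^ m j)"
    have "poly P (b i) \<noteq> 0"
    proof -
      have "b i \<noteq> b j" if "j \<in> A" for j
        using inj_onD[OF insert.prems(1), of i j] insert.hyps that by blast
      then show ?thesis
        using insert.hyps(1) by (simp add: P_def poly_prod)
    qed
    then have "order (b i) P = 0" "P \<noteq> 0"
      by (auto simp: order_0I)
    moreover have "[:- b i, 1:] ^ m i dvd P * g"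
      using insert.prems(2) unfolding g P_def by blast
    ultimately have "[:- b i, 1:] ^ m i dvd g"
      using \<open>P \<noteq> 0\<close> by (cases "g = 0") (simp_all only: order_divides order_mult mult_eq_0_iff add_0 dvd_0_right simp_thms)
    then have "[:- b i, 1:] ^ m i * P dvd g * P"
      by (rule mult_dvd_mono) simp
    then show ?case
      unfolding g P_def by (simp only: prod.insert[OF insert.hyps(1,2)] mult.commute)
  qed simp
next
  assume *: "(\<Prod>j\<in>A. [:- b j, 1:] ^ m j) dvd p"
  show "\<forall>j\<in>A. [:- b j, 1:] ^ m j dvd p"
  proof
    fix j assume "j \<in> A"
    with assms(2) have "[:- b j, 1:] ^ m j dvd (\<Prod>j\<in>A. [:- b j, 1:] ^ m j)"
      by (rule dvd_prodI)
    then show "[:- b j, 1:] ^ m j dvd p" using * by (rule dvd_trans)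
  qed
qed

lemma monic_dvd_eqI:
  fixes p P :: "'a::idom poly"
  assumes "P dvd p" "degree p = degree P" "lead_coeff p = 1" "lead_coeff P = 1"
  shows "p = P"
proof -
  from assms(1) obtain c where c: "p = P * c" by (rule dvdE)
  have "P \<noteq> 0" "c \<noteq> 0" using assms(3,4) c by auto
  then have "degree c = 0"
    using assms(2) by (simp add: c degree_mult_eq)
  then obtain d where d: "c = [:d:]" by (rule degree_eq_zeroE)
  have "lead_coeff p = lead_coeff P * lead_coeff c"
    unfolding c by (rule lead_coeff_mult)
  with assms(3,4) show ?thesis by (simp add: c d one_pCons)
qed

text \<open>Existence and uniqueness come together: \<open>heat 1\<close> is a bijection which preserves the degree and the
leading coefficient, and a monic polynomial of degree \<open>\<Sum> n j\<close> that vanishes to order \<open>n j\<close> at each of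
the distinct points \<open>b j\<close> is the product of the \<open>(x - b j) ^ n j\<close>.\<close>
lemma multiple_hermite_eq_heat:
  assumes "inj_on b {..<r}"
  shows "multiple_hermite r n b = heat (- 1) (\<Prod>j<r. [:- b j, 1:] ^ n j)"
proof -
  let ?P = "\<Prod>j<r. [:- b j, 1:] ^ n j"
  have deg: "degree ?P = (\<Sum>j<r. n j)"
    by (subst degree_prod_eq_sum_degree) (auto simp: degree_power_eq)
  have lead: "lead_coeff ?P = 1"
    by (simp add: lead_coeff_prod lead_coeff_power)
  have "is_multiple_hermite r n b p \<longleftrightarrow> heat 1 p = ?P" for p
  proof -
    have int: "(LINT x|lborel. x ^ k * poly p x * exp (b j * x) * exp (- x\<^sup>2 / 2)) = 0
        \<longleftrightarrow> poly (heat 1 (monom 1 k * p)) (b j) = 0" for j k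
      using gaussian_integral_poly[of "monom 1 k * p" "b j"] by (simp add: poly_monom)
    have "is_multiple_hermite r n b p \<longleftrightarrow>
        lead_coeff (heat 1 p) = 1 \<and> degree (heat 1 p) = degree ?P \<and> ?P dvd heat 1 p"
      unfolding is_multiple_hermite_def int deg prod_linear_power_dvd_iff[OF assms finite_lessThan]
        linear_power_dvd_heat_iff degree_heat lead_coeff_heat by auto
    also have "\<dots> \<longleftrightarrow> heat 1 p = ?P"
    proof
      assume "lead_coeff (heat 1 p) = 1 \<and> degree (heat 1 p) = degree ?P \<and> ?P dvd heat 1 p"
      then show "heat 1 p = ?P"
        using lead by (intro monic_dvd_eqI) blast+
    next
      assume "heat 1 p = ?P"
      then show "lead_coeff (heat 1 p) = 1 \<and> degree (heat 1 p) = degree ?P \<and> ?P dvd heat 1 p"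
        using lead by (simp only: dvd_refl simp_thms)
    qed
    finally show ?thesis .
  qed
  moreover have "heat 1 p = ?P \<longleftrightarrow> p = heat (- 1) ?P" for p
    using heat_heat_inverse[of 1 p] heat_heat_inverse[of "- 1" ?P] by auto
  ultimately show ?thesis
    by (simp add: multiple_hermite_def)
qed

section \<open>Reality and boundedness of the zeros\<close>

abbreviation root_poly :: "real multiset \<Rightarrow> real poly" where
  "root_poly Z \<equiv> (\<Prod>x\<in>#Z. [:- x, 1:])"

lemma monic_root_poly: "degree (root_poly Z) = size Z \<and> lead_coeff (root_poly Z) = 1"
proof (induction Z)
  case (add x Z)
  then have "root_poly Z \<noteq> 0" by auto
  with add have deg: "degree ([:- x, 1:] * root_poly Z) = Suc (size Z)"
    by (subst degree_mult_eq) auto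
  have "lead_coeff ([:- x, 1:] * root_poly Z) = 1"
    unfolding lead_coeff_mult by (simp add: conjunct2[OF add.IH])
  with deg show ?case by simp
qed simp

text \<open>The formula \<open>P'/P = \<Sum> 1/(x - z)\<close> after a ring homomorphism into a field. It is used for evaluation at
a nonreal point, and for the expansion at infinity.\<close>
lemma log_derivative_hom:
  fixes \<phi> :: "real poly \<Rightarrow> 'a::field"
  assumes add: "\<And>p q. \<phi> (p + q) = \<phi> p + \<phi> q" and mult: "\<And>p q. \<phi> (p * q) = \<phi> p * \<phi> q"
    and nz: "\<And>x. x \<in># Z \<Longrightarrow> \<phi> [:- x, 1:] \<noteq> 0"
  shows "\<phi> (pderiv (root_poly Z)) = \<phi> (root_poly Z) * (\<Sum>x\<in>#Z. 1 / \<phi> [:- x, 1:])"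
  using nz
proof (induction Z)
  case empty
  have "\<phi> 0 = 0" using assms(1)[of 0 0] by (metis add.right_neutral add_left_cancel)
  then show ?case by simp
next
  case (add x Z)
  then have "\<phi> [:- x, 1:] \<noteq> 0" by simp
  moreover have "pderiv (root_poly (add_mset x Z)) = [:- x, 1:] * pderiv (root_poly Z) + root_poly Z"
    by (simp only: image_mset_add_mset prod_mset.add_mset pderiv_mult) (simp add: pderiv_pCons)
  moreover have "\<phi> (pderiv (root_poly Z)) = \<phi> (root_poly Z) * (\<Sum>x\<in>#Z. 1 / \<phi> [:- x, 1:])"
    using add by simp
  ultimately show ?case
    by (simp only: image_mset_add_mset prod_mset.add_mset sum_mset.add_mset assms(1) mult) (simp add: field_simps)
qed

lemma map_poly_of_real_add: "map_poly complex_of_real (p + q) = map_poly of_real p + map_poly of_real q"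
  by (rule poly_eqI) (simp add: coeff_map_poly)

lemma map_poly_of_real_mult: "map_poly complex_of_real (p * q) = map_poly of_real p * map_poly of_real q"
  by (rule poly_eqI) (simp add: coeff_map_poly coeff_mult)

lemma map_poly_of_real_smult: "map_poly complex_of_real (smult c p) = smult (of_real c) (map_poly of_real p)"
  by (rule poly_eqI) (simp add: coeff_map_poly)

lemma map_poly_of_real_root_poly:
  "map_poly complex_of_real (root_poly Z) = (\<Prod>x\<in>#Z. [:- of_real x, 1:])"
  by (induction Z) (simp_all add: map_poly_of_real_mult map_poly_pCons del: mult_pCons_left)

lemma splits_over_reals:
  assumes "lead_coeff p = 1" and real: "\<And>z. poly (map_poly complex_of_real p) z = 0 \<Longrightarrow> Im z = 0"
  shows "\<exists>Z. p = root_poly Z"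
proof -
  let ?q = "map_poly complex_of_real p"
  have lead: "lead_coeff ?q = 1" and "?q \<noteq> 0"
    using assms(1) by (auto simp: degree_map_poly coeff_map_poly map_poly_eq_0_iff)
  have "?q = (\<Prod>z\<in>#proots ?q. [:- z, 1:])"
    using complex_poly_decompose_multiset[of ?q] lead by simp
  also have "\<dots> = (\<Prod>z\<in>#proots ?q. [:- of_real (Re z), 1:])"
    using real \<open>?q \<noteq> 0\<close>
    by (intro arg_cong[where f = prod_mset] image_mset_cong) (auto simp: complex_eq_iff)
  also have "\<dots> = map_poly of_real (root_poly (image_mset Re (proots ?q)))"
    unfolding map_poly_of_real_root_poly by (simp add: image_mset.compositionality o_def)
  finally have "coeff ?q i = coeff (map_poly of_real (root_poly (image_mset Re (proots ?q)))) i" for i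
    by simp
  then have "p = root_poly (image_mset Re (proots ?q))"
    by (intro poly_eqI) (simp add: coeff_map_poly)
  then show ?thesis ..
qed

lemma proots_map_of_real_root_poly: "proots (map_poly complex_of_real (root_poly Z)) = image_mset of_real Z"
proof -
  have "proots (\<Prod>x\<in>#Z. [:- complex_of_real x, 1:]) = image_mset of_real Z"
  proof (induction Z)
    case (add x Z)
    have "(\<Prod>x\<in>#Z. [:- complex_of_real x, 1:]) \<noteq> 0" by (auto simp: prod_mset_zero_iff)
    then show ?case
      using add by (simp add: proots_mult del: mult_pCons_left)
  qed simp
  then show ?thesis by (simp only: map_poly_of_real_root_poly)
qed

text \<open>At a point \<open>z\<close> with positive imaginary part all the \<open>1/(z - x)\<close> have negative imaginary part, hence the
imaginary part of \<open>P'/P\<close> is at most 0; thus \<open>z - a + s P'/P\<close> has positive imaginary part for \<open>s \<le> 0\<close> and cannot vanish. The lower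
half-plane is symmetric.\<close>
lemma real_rooted_step:
  assumes "s \<le> 0"
  shows "\<exists>Z'. [:- a, 1:] * root_poly Z + smult s (pderiv (root_poly Z)) = root_poly Z'"
proof (rule splits_over_reals)
  let ?P = "root_poly Z" and ?\<phi> = "\<lambda>z p. poly (map_poly complex_of_real p) z"
  let ?q = "[:- a, 1:] * ?P + smult s (pderiv ?P)"
  have "root_poly (add_mset a Z) = [:- a, 1:] * ?P" by simp
  then have "degree ([:- a, 1:] * ?P) = Suc (size Z)" "lead_coeff ([:- a, 1:] * ?P) = 1"
    using monic_root_poly[of "add_mset a Z"] unfolding \<open>root_poly (add_mset a Z) = _\<close> size_add_mset by blast+
  moreover have "degree (smult s (pderiv ?P)) < Suc (size Z)"
    using monic_root_poly[of Z] by (intro le_imp_less_Suc order.trans[OF degree_smult_le]) (simp add: degree_pderiv)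
  ultimately show "lead_coeff ?q = 1"
    by (simp only: degree_add_eq_left lead_coeff_add_le add.commute[of _ "smult s _"])
  fix z assume root: "?\<phi> z ?q = 0"
  show "Im z = 0"
  proof (rule ccontr)
    assume Im: "Im z \<noteq> 0"
    then have nz: "z \<noteq> of_real x" for x by auto
    have lin: "?\<phi> z [:- x, 1:] = z - of_real x" for x
      by (simp add: map_poly_pCons)
    have P: "?\<phi> z ?P \<noteq> 0"
      by (induction Z) (simp_all add: map_poly_of_real_mult lin nz del: mult_pCons_left)
    have "?\<phi> z (pderiv ?P) = ?\<phi> z ?P * (\<Sum>x\<in>#Z. 1 / (z - of_real x))"
      using log_derivative_hom[of "?\<phi> z" Z]
      by (simp add: map_poly_of_real_add map_poly_of_real_mult lin nz)
    then have "?\<phi> z ?P * (z - of_real a + of_real s * (\<Sum>x\<in>#Z. 1 / (z - of_real x))) = 0"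
      using root
      by (simp only: map_poly_of_real_add map_poly_of_real_mult map_poly_of_real_smult poly_add poly_mult poly_smult lin)
         (simp add: algebra_simps)
    then have "Im (z - of_real a + of_real s * (\<Sum>x\<in>#Z. 1 / (z - of_real x))) = 0"
      using P by simp
    moreover have "Im (\<Sum>x\<in>#Z. 1 / (z - of_real x)) = - Im z * (\<Sum>x\<in>#Z. 1 / (cmod (z - of_real x))\<^sup>2)"
      by (induction Z) (simp_all add: Im_divide cmod_power2 algebra_simps)
    ultimately have "Im z * (1 - s * (\<Sum>x\<in>#Z. 1 / (cmod (z - of_real x))\<^sup>2)) = 0"
      by (simp add: algebra_simps)
    moreover have "0 \<le> (\<Sum>x\<in>#Z. 1 / (cmod (z - of_real x))\<^sup>2)"
      by (induction Z) simp_all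
    then have "s * (\<Sum>x\<in>#Z. 1 / (cmod (z - of_real x))\<^sup>2) \<le> 0"
      using assms by (simp add: mult_nonpos_nonneg)
    ultimately show False using Im by simp
  qed
qed

lemma heat_real_rooted:
  assumes "s \<le> 0"
  shows "\<exists>Z. heat s (root_poly Y) = root_poly Z"
proof (induction Y)
  case empty
  have "heat s (root_poly {#}) = root_poly {#}" by simp
  then show ?case ..
next
  case (add a Y)
  then obtain Z where "heat s (root_poly Y) = root_poly Z" by blast
  then show ?case
    using real_rooted_step[OF assms, of a Z] heat_linear_mult[of s "- a" 1 "root_poly Y"] by simp
qed

text \<open>These are the Hermite polynomials, scaled so that their three-term recursion is
\<open>h\<^sub>m\<^sub>+\<^sub>1 = x h\<^sub>m - (m/N) h\<^sub>m\<^sub>-\<^sub>1\<close>. For \<open>x \<ge> 2\<close> and \<open>m \<le> N\<close> the sequence is positive and nondecreasing in \<open>m\<close>, since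
\<open>h\<^sub>m\<^sub>+\<^sub>1 \<ge> 2 h\<^sub>m - h\<^sub>m\<^sub>-\<^sub>1\<close>.\<close>
lemma heat_monom_pos:
  assumes "0 < N" "2 \<le> x" "m \<le> N"
  shows "0 < poly (heat (- 1 / real N) (monom 1 m)) x"
proof -
  let ?h = "\<lambda>m. poly (heat (- 1 / real N) (monom 1 m)) x"
  have rec: "?h (Suc m) = x * ?h m - real m / real N * ?h (m - 1)" for m
  proof -
    have "pderiv (monom 1 m) = smult (real m) (monom 1 (m - 1))"
      by (simp add: pderiv_monom smult_monom)
    then have "pderiv (heat s (monom 1 m)) = smult (real m) (heat s (monom 1 (m - 1)))" for s
      by (simp only: heat_pderiv[symmetric] heat_smult)
    then show ?thesis
      by (simp add: monom_Suc heat_X_mult)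
  qed
  have "0 < ?h m \<and> (Suc m \<le> N \<longrightarrow> ?h m \<le> ?h (Suc m))"
    using assms(3)
  proof (induction m)
    case 0
    then show ?case using rec[of 0] assms by (simp add: monom_0)
  next
    case (Suc m)
    then have IH: "0 < ?h m" "?h m \<le> ?h (Suc m)" by auto
    have "real (Suc m) / real N * ?h m \<le> 1 * ?h m"
      using Suc.prems IH assms(1) by (intro mult_right_mono) auto
    moreover have "2 * ?h (Suc m) \<le> x * ?h (Suc m)"
      using assms(2) IH by (intro mult_right_mono) auto
    moreover have "?h (Suc (Suc m)) = x * ?h (Suc m) - real (Suc m) / real N * ?h m"
      using rec[of "Suc m"] by (simp only: diff_Suc_1)
    ultimately have "?h (Suc m) \<le> ?h (Suc (Suc m))"
      using IH by linarith
    then show ?case using IH by linarith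
  qed
  then show ?thesis by blast
qed

lemma heat_pos:
  assumes "0 < N" "2 \<le> x" "degree p \<le> N" "\<And>i. 0 \<le> coeff p i" "p \<noteq> 0"
  shows "0 < poly (heat (- 1 / real N) p) x"
proof -
  have "heat (- 1 / real N) p = heat (- 1 / real N) (\<Sum>i\<le>degree p. smult (coeff p i) (monom 1 i))"
    by (simp add: smult_monom poly_as_sum_of_monoms)
  then have "poly (heat (- 1 / real N) p) x
      = (\<Sum>i\<le>degree p. coeff p i * poly (heat (- 1 / real N) (monom 1 i)) x)"
    by (simp add: heat_sum heat_smult poly_sum del: smult_monom)
  also have "\<dots> > 0"
  proof (rule sum_pos2[of _ "degree p"])
    show "0 < coeff p (degree p) * poly (heat (- 1 / real N) (monom 1 (degree p))) x"
      using heat_monom_pos[OF assms(1-3)] assms(4)[of "degree p"] assms(5)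
      by (intro mult_pos_pos) (auto simp: order.strict_iff_order)
    show "0 \<le> coeff p i * poly (heat (- 1 / real N) (monom 1 i)) x" if "i \<in> {..degree p}" for i
      using heat_monom_pos[OF assms(1,2), of i] assms(3) assms(4)[of i] that by simp
  qed simp_all
  finally show ?thesis .
qed

lemma coeff_root_poly_nonneg:
  assumes "\<And>y. y \<in># Y \<Longrightarrow> y \<le> 0"
  shows "0 \<le> coeff (root_poly Y) i"
  using assms
proof (induction Y arbitrary: i)
  case (add y Y)
  then have "0 \<le> coeff (root_poly Y) j" "y \<le> 0" for j by auto
  then show ?case by (cases i) (auto intro: order.trans[OF mult_nonpos_nonneg])
qed simp

text \<open>Translation by \<open>A\<close> moves all the zeros of \<open>root_poly Y\<close> into \<open>(-\<infinity>, 0]\<close>, so that its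
coefficients become nonnegative, and positivity on \<open>[2, \<infinity>)\<close> excludes zeros beyond \<open>A + 2\<close>. Reflection
gives the other side; both are handled by the affine map \<open>y \<mapsto> e (A + y)\<close> with \<open>e = \<plusminus>1\<close>.\<close>
lemma heat_root_bound:
  assumes "0 < N" "size Y \<le> N" and A: "\<And>y. y \<in># Y \<Longrightarrow> \<bar>y\<bar> \<le> A"
    and root: "poly (heat (- 1 / real N) (root_poly Y)) x = 0"
  shows "\<bar>x\<bar> \<le> A + 2"
proof (rule ccontr)
  assume x: "\<not> \<bar>x\<bar> \<le> A + 2"
  define e where "e = (if x < 0 then - 1 else 1 :: real)"
  have e: "e * e = 1" "e\<^sup>2 = 1" "\<bar>x\<bar> = e * x" and "e \<noteq> 0"
    by (auto simp: e_def)
  let ?Y = "image_mset (\<lambda>y. e * y - A) Y"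
  have comp: "pcompose (root_poly Y) [:e * A, e:] = smult (e ^ size Y) (root_poly ?Y)"
  proof (induction Y)
    case (add y Y)
    have "pcompose [:- y, 1:] [:e * A, e:] = smult e [:- (e * y - A), 1:]"
      using e by (simp add: pcompose_pCons algebra_simps flip: mult.assoc)
    then show ?case
      by (simp only: image_mset_add_mset prod_mset.add_mset pcompose_mult add.IH mult_smult_left
        mult_smult_right smult_smult power_Suc size_add_mset mult.commute[of e "e ^ size Y"])
  qed (simp add: pcompose_1)
  have "0 < poly (heat (- 1 / real N) (root_poly ?Y)) (\<bar>x\<bar> - A)"
  proof (rule heat_pos)
    show "degree (root_poly ?Y) \<le> N" "root_poly ?Y \<noteq> 0"
      using monic_root_poly[of ?Y] assms(2) by auto
    show "0 \<le> coeff (root_poly ?Y) i" for i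
    proof (rule coeff_root_poly_nonneg)
      fix z assume "z \<in># ?Y"
      then obtain y where "y \<in># Y" "z = e * y - A" by auto
      then show "z \<le> 0" using A[of y] by (auto simp: e_def split: if_splits)
    qed
  qed (use x assms in auto)
  moreover have "smult (e ^ size Y) (heat (- 1 / real N) (root_poly ?Y))
      = pcompose (heat (- 1 / real N) (root_poly Y)) [:e * A, e:]"
    using heat_pcompose_affine[of "- 1 / real N" "root_poly Y" "e * A" e]
    by (simp add: comp heat_smult e)
  then have "e ^ size Y * poly (heat (- 1 / real N) (root_poly ?Y)) (\<bar>x\<bar> - A)
      = poly (pcompose (heat (- 1 / real N) (root_poly Y)) [:e * A, e:]) (\<bar>x\<bar> - A)"
    by (metis poly_smult)
  moreover have "poly [:e * A, e:] (\<bar>x\<bar> - A) = x"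
    using e by (simp add: algebra_simps flip: mult.assoc)
  ultimately show False
    using root \<open>e \<noteq> 0\<close> by (simp add: poly_pcompose del: poly_pCons)
qed

lemma heat_root_poly:
  assumes "0 < N" "size Y = N" "\<And>y. y \<in># Y \<Longrightarrow> \<bar>y\<bar> \<le> A"
  obtains Z where "heat (- 1 / real N) (root_poly Y) = root_poly Z" "size Z = N"
    "\<And>z. z \<in># Z \<Longrightarrow> \<bar>z\<bar> \<le> A + 2"
proof -
  obtain Z where Z: "heat (- 1 / real N) (root_poly Y) = root_poly Z"
    using heat_real_rooted[of "- 1 / real N" Y] by auto
  moreover have "size Z = N"
    using arg_cong[OF Z, of degree] monic_root_poly[of Y] monic_root_poly[of Z] assms(2) by simp
  moreover have "\<bar>z\<bar> \<le> A + 2" if "z \<in># Z" for z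
  proof (rule heat_root_bound[OF assms(1) _ assms(3)])
    from multi_member_split[OF that] obtain Z' where "Z = add_mset z Z'" by blast
    then have "poly (root_poly Z) z = 0" by simp
    then show "poly (heat (- 1 / real N) (root_poly Y)) z = 0" by (simp only: Z)
  qed (use assms(2) in auto)
  ultimately show thesis by (rule that)
qed

section \<open>Expansion of polynomials at infinity\<close>

text \<open>The Laurent series of \<open>p(1/w)\<close>, that is, of \<open>p(z)\<close> in the variable \<open>w = 1/z\<close>. Working with formal
series allows division by polynomials and turns \<open>d/dz\<close> into \<open>-w\<^sup>2 d/dw\<close>.\<close>
definition poly_at_inv :: "real poly \<Rightarrow> real fls" where
  "poly_at_inv p = poly (map_poly fls_const p) fls_X_inv"

lemma poly_at_inv_0 [simp]: "poly_at_inv 0 = 0"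
  by (simp add: poly_at_inv_def)

lemma poly_at_inv_pCons [simp]: "poly_at_inv (pCons c p) = fls_const c + fls_X_inv * poly_at_inv p"
  by (simp add: poly_at_inv_def map_poly_pCons)

lemma poly_at_inv_1 [simp]: "poly_at_inv 1 = 1"
  by (simp add: one_pCons)

lemma poly_at_inv_add: "poly_at_inv (p + q) = poly_at_inv p + poly_at_inv q"
proof (induction p arbitrary: q)
  case (pCons c p)
  obtain d q' where q: "q = pCons d q'" by (cases q)
  have "fls_const (c + d) = fls_const c + fls_const d" by (simp add: fls_plus_const)
  then show ?case
    using pCons.IH[of q'] by (simp add: q distrib_left)
qed simp

lemma poly_at_inv_smult: "poly_at_inv (smult a p) = fls_const a * poly_at_inv p"
proof (induction p)
  case (pCons c p)
  have "fls_const (a * c) = fls_const a * fls_const c" by (simp add: fls_const_mult_const)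
  then show ?case
    using pCons.IH by (simp add: distrib_left mult.left_commute)
qed simp

lemma poly_at_inv_mult: "poly_at_inv (p * q) = poly_at_inv p * poly_at_inv q"
  by (induction p) (simp_all add: poly_at_inv_add poly_at_inv_smult algebra_simps)

lemma fls_X_mult_X_inv: "fls_X * fls_X_inv = (1 :: real fls)" "fls_X * (fls_X_inv * f) = (f :: real fls)"
proof -
  show "fls_X * fls_X_inv = (1 :: real fls)" by (metis fls_inverse_X_inv fls_X_inv_nonzero left_inverse)
  then show "fls_X * (fls_X_inv * f) = (f :: real fls)" by (simp flip: mult.assoc)
qed

lemma poly_at_inv_pderiv: "poly_at_inv (pderiv p) = - (fls_X\<^sup>2 * fls_deriv (poly_at_inv p))"
proof (induction p)
  case (pCons c p)
  then show ?case
    by (simp add: pderiv_pCons poly_at_inv_add power2_eq_square algebra_simps fls_X_mult_X_inv)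
qed simp

text \<open>The Cauchy transform of the uniform distribution on \<open>Z\<close>, as a power series in \<open>w = 1/z\<close>.\<close>
definition moment_series :: "real multiset \<Rightarrow> real fps" where
  "moment_series Z = fps_X * Abs_fps (\<lambda>k. (\<Sum>x\<in>#Z. x ^ k) / size Z)"

lemma geometric_fps: "Abs_fps (\<lambda>k. a ^ k) * (1 - fps_const a * fps_X) = (1 :: real fps)"
proof (rule fps_ext)
  fix k
  have "Abs_fps (\<lambda>k. a ^ k) * (1 - fps_const a * fps_X)
      = Abs_fps (\<lambda>k. a ^ k) - fps_const a * (fps_X * Abs_fps (\<lambda>k. a ^ k))"
    by (simp add: algebra_simps)
  then show "(Abs_fps (\<lambda>k. a ^ k) * (1 - fps_const a * fps_X)) $ k = (1 :: real fps) $ k"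
    by (cases k) simp_all
qed

lemma poly_at_inv_linear_mult: "poly_at_inv [:- x, 1:] * fps_to_fls (fps_X * Abs_fps (\<lambda>k. x ^ k)) = 1"
proof -
  have "poly_at_inv [:- x, 1:] * fls_X = fps_to_fls (1 - fps_const x * fps_X)"
    by (simp add: algebra_simps fls_X_mult_X_inv fls_times_fps_to_fls)
  then have "poly_at_inv [:- x, 1:] * fps_to_fls (fps_X * Abs_fps (\<lambda>k. x ^ k))
      = fps_to_fls (Abs_fps (\<lambda>k. x ^ k) * (1 - fps_const x * fps_X))"
    by (simp add: fls_times_fps_to_fls mult_ac)
  then show ?thesis by (simp add: geometric_fps)
qed

lemma poly_at_inv_linear_nz: "poly_at_inv [:- x, 1:] \<noteq> 0"
  using poly_at_inv_linear_mult[of x] by (metis mult_zero_left zero_neq_one)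

lemma poly_at_inv_root_poly_nz: "poly_at_inv (root_poly Z) \<noteq> 0"
  by (induction Z) (simp_all add: poly_at_inv_mult poly_at_inv_linear_nz
      del: poly_at_inv_pCons mult_pCons_left)

lemma poly_at_inv_log_derivative:
  "poly_at_inv (pderiv (root_poly Z))
     = of_nat (size Z) * fps_to_fls (moment_series Z) * poly_at_inv (root_poly Z)"
proof (cases "Z = {#}")
  case False
  have inv: "1 / poly_at_inv [:- x, 1:] = fps_to_fls (fps_X * Abs_fps (\<lambda>k. x ^ k))" for x
    using inverse_unique[OF poly_at_inv_linear_mult[of x]] by (simp only: inverse_eq_divide)
  have "poly_at_inv (pderiv (root_poly Z))
      = poly_at_inv (root_poly Z) * (\<Sum>x\<in>#Z. 1 / poly_at_inv [:- x, 1:])"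
    by (rule log_derivative_hom) (use poly_at_inv_add poly_at_inv_mult poly_at_inv_linear_nz in auto)
  also have "(\<Sum>x\<in>#Z. 1 / poly_at_inv [:- x, 1:]) = fps_to_fls (fps_X * Abs_fps (\<lambda>k. \<Sum>x\<in>#Z. x ^ k))"
    unfolding inv
  proof (induction Z)
    case empty
    have "Abs_fps (\<lambda>k. 0) = (0 :: real fps)" by (rule fps_ext) simp
    then show ?case by simp
  next
    case (add x Z)
    have "Abs_fps (\<lambda>k. x ^ k + (\<Sum>x\<in>#Z. x ^ k)) = Abs_fps (\<lambda>k. x ^ k) + Abs_fps (\<lambda>k. \<Sum>x\<in>#Z. x ^ k)"
      by (rule fps_ext) simp
    then show ?case using add by (simp add: distrib_left)
  qed
  also have "fps_X * Abs_fps (\<lambda>k. \<Sum>x\<in>#Z. x ^ k) = of_nat (size Z) * moment_series Z"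
  proof -
    have "Abs_fps (\<lambda>k. \<Sum>x\<in>#Z. x ^ k) = of_nat (size Z) * Abs_fps (\<lambda>k. (\<Sum>x\<in>#Z. x ^ k) / size Z)"
      using False by (intro fps_ext) (simp add: fps_of_nat[symmetric])
    then show ?thesis by (simp add: moment_series_def mult_ac)
  qed
  finally show ?thesis
    by (simp add: fls_times_fps_to_fls mult_ac)
qed simp

section \<open>The limiting equation for the moments of the zeros\<close>

definition fps_tendsto :: "(nat \<Rightarrow> real fps) \<Rightarrow> real fps \<Rightarrow> bool" where
  "fps_tendsto v V \<longleftrightarrow> (\<forall>k. (\<lambda>i. v i $ k) \<longlonglongrightarrow> V $ k)"

lemma fps_tendsto_const: "fps_tendsto (\<lambda>i. V) V"
  by (simp add: fps_tendsto_def)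

lemma fps_tendsto_fps_const: "c \<longlonglongrightarrow> C \<Longrightarrow> fps_tendsto (\<lambda>i. fps_const (c i)) (fps_const C)"
  by (simp add: fps_tendsto_def)

lemma fps_tendsto_add: "fps_tendsto v V \<Longrightarrow> fps_tendsto w W \<Longrightarrow> fps_tendsto (\<lambda>i. v i + w i) (V + W)"
  by (simp add: fps_tendsto_def tendsto_add)

lemma fps_tendsto_diff: "fps_tendsto v V \<Longrightarrow> fps_tendsto w W \<Longrightarrow> fps_tendsto (\<lambda>i. v i - w i) (V - W)"
  by (simp add: fps_tendsto_def tendsto_diff)

lemma fps_tendsto_mult: "fps_tendsto v V \<Longrightarrow> fps_tendsto w W \<Longrightarrow> fps_tendsto (\<lambda>i. v i * w i) (V * W)"
  by (simp add: fps_tendsto_def fps_mult_nth tendsto_sum tendsto_mult)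

lemma fps_tendsto_deriv: "fps_tendsto v V \<Longrightarrow> fps_tendsto (\<lambda>i. fps_deriv (v i)) (fps_deriv V)"
  by (simp add: fps_tendsto_def tendsto_mult)

lemma fps_tendsto_unique: "fps_tendsto v V \<Longrightarrow> fps_tendsto v W \<Longrightarrow> V = W"
  by (auto simp: fps_tendsto_def intro: fps_ext LIMSEQ_unique)

text \<open>Along a sequence of degrees \<open>d i\<close> tending to infinity, the moments of the zeros \<open>Z i\<close> of
\<open>heat (-1/d) P\<close> converge to those encoded by \<open>G\<close>.\<close>
locale heat_zeros =
  fixes d :: "nat \<Rightarrow> nat" and P :: "nat \<Rightarrow> real poly" and Z :: "nat \<Rightarrow> real multiset" and G :: "real fps"
  assumes d_pos: "0 < d i" and d_lim: "(\<lambda>i. 1 / real (d i)) \<longlonglongrightarrow> 0"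
    and heat_P: "heat (- 1 / real (d i)) (P i) = root_poly (Z i)" and size_Z: "size (Z i) = d i"
    and G: "fps_tendsto (\<lambda>i. moment_series (Z i)) G"
begin

text \<open>The quotients \<open>heat (-1/d) f / heat (-1/d) P\<close>, as series in \<open>w = 1/z\<close>, converge to \<open>z\<^sup>l V(w)\<close>
coefficientwise. The factor \<open>w\<^sup>l\<close> keeps everything inside the power series.\<close>
definition heat_ratio_limit :: "nat \<Rightarrow> (nat \<Rightarrow> real poly) \<Rightarrow> real fps \<Rightarrow> bool" where
  "heat_ratio_limit l f V \<longleftrightarrow> (\<exists>v. fps_tendsto v V \<and>
     (\<forall>i. fls_X ^ l * poly_at_inv (heat (- 1 / real (d i)) (f i))
        = fps_to_fls (v i) * poly_at_inv (root_poly (Z i))))"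

lemma heat_ratio_limit_unique:
  assumes "heat_ratio_limit l f V" "heat_ratio_limit l f W"
  shows "V = W"
proof -
  obtain v w where v: "fps_tendsto v V" and w: "fps_tendsto w W" and
    "\<And>i. fps_to_fls (v i) * poly_at_inv (root_poly (Z i)) = fps_to_fls (w i) * poly_at_inv (root_poly (Z i))"
    using assms unfolding heat_ratio_limit_def by metis
  then have "v i = w i" for i
    using poly_at_inv_root_poly_nz[of "Z i"] by (metis mult_right_cancel fps_to_fls_eq_iff)
  then have "v = w" by (rule ext)
  with v w show ?thesis by (blast intro: fps_tendsto_unique)
qed

lemma heat_ratio_limit_P: "heat_ratio_limit 0 P 1"
  unfolding heat_ratio_limit_def
  by (intro exI[of _ "\<lambda>i. 1"] conjI fps_tendsto_const) (simp add: heat_P del: divide_minus_left)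

lemma heat_ratio_limit_deriv: "heat_ratio_limit 0 (\<lambda>i. smult (1 / real (d i)) (pderiv (P i))) G"
  unfolding heat_ratio_limit_def
proof (intro exI[of _ "\<lambda>i. moment_series (Z i)"] conjI G allI)
  fix i
  have "fls_const (1 / real (d i)) * of_nat (d i) = fls_const (1 / real (d i) * real (d i))"
    by (simp only: fls_of_nat fls_const_mult_const)
  also have "\<dots> = 1" using d_pos[of i] by simp
  finally show "fls_X ^ 0 * poly_at_inv (heat (- 1 / real (d i)) (smult (1 / real (d i)) (pderiv (P i))))
      = fps_to_fls (moment_series (Z i)) * poly_at_inv (root_poly (Z i))"
    by (simp only: heat_smult heat_pderiv heat_P poly_at_inv_smult poly_at_inv_log_derivative size_Z
        power_0 mult_1 mult.assoc[symmetric])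
qed

lemma heat_ratio_limit_shift:
  assumes "heat_ratio_limit l f V"
  shows "heat_ratio_limit (Suc l) f (fps_X * V)"
proof -
  obtain v where "fps_tendsto v V" and
    "\<And>i. fls_X ^ l * poly_at_inv (heat (- 1 / real (d i)) (f i))
        = fps_to_fls (v i) * poly_at_inv (root_poly (Z i))"
    using assms unfolding heat_ratio_limit_def by blast
  then show ?thesis
    unfolding heat_ratio_limit_def
    by (intro exI[of _ "\<lambda>i. fps_X * v i"] conjI fps_tendsto_mult fps_tendsto_const)
      (simp_all only: power_Suc mult.assoc fls_times_fps_to_fls fps_X_to_fls simp_thms)
qed

lemma heat_ratio_limit_smult:
  assumes "heat_ratio_limit l f V" "c \<longlonglongrightarrow> C"
  shows "heat_ratio_limit l (\<lambda>i. smult (c i) (f i)) (fps_const C * V)"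
proof -
  obtain v where "fps_tendsto v V" and
    *: "\<And>i. fls_X ^ l * poly_at_inv (heat (- 1 / real (d i)) (f i))
        = fps_to_fls (v i) * poly_at_inv (root_poly (Z i))"
    using assms unfolding heat_ratio_limit_def by blast
  then have "fps_tendsto (\<lambda>i. fps_const (c i) * v i) (fps_const C * V)"
    by (intro fps_tendsto_mult fps_tendsto_fps_const assms(2))
  moreover have "fls_X ^ l * poly_at_inv (heat (- 1 / real (d i)) (smult (c i) (f i)))
        = fps_to_fls (fps_const (c i) * v i) * poly_at_inv (root_poly (Z i))" for i
    by (simp only: heat_smult poly_at_inv_smult fls_times_fps_to_fls fps_const_to_fls mult.assoc mult.left_commute[of _ "fls_const _"] *)
  ultimately show ?thesis
    unfolding heat_ratio_limit_def by blast
qed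

lemma heat_ratio_limit_add:
  assumes "heat_ratio_limit l f V" "heat_ratio_limit l g W"
  shows "heat_ratio_limit l (\<lambda>i. f i + g i) (V + W)"
proof -
  obtain v where "fps_tendsto v V" and
    v: "\<And>i. fls_X ^ l * poly_at_inv (heat (- 1 / real (d i)) (f i))
        = fps_to_fls (v i) * poly_at_inv (root_poly (Z i))"
    using assms(1) unfolding heat_ratio_limit_def by blast
  obtain w where "fps_tendsto w W" and
    w: "\<And>i. fls_X ^ l * poly_at_inv (heat (- 1 / real (d i)) (g i))
        = fps_to_fls (w i) * poly_at_inv (root_poly (Z i))"
    using assms(2) unfolding heat_ratio_limit_def by blast
  have "fps_tendsto (\<lambda>i. v i + w i) (V + W)"
    by (intro fps_tendsto_add) fact+
  moreover have "fls_X ^ l * poly_at_inv (heat (- 1 / real (d i)) (f i + g i))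
        = fps_to_fls (v i + w i) * poly_at_inv (root_poly (Z i))" for i
    by (simp only: heat_add poly_at_inv_add fps_to_fls_plus distrib_left distrib_right v w)
  ultimately show ?thesis
    unfolding heat_ratio_limit_def by blast
qed

lemma heat_ratio_limit_sum:
  assumes "\<And>j. j \<in> A \<Longrightarrow> heat_ratio_limit l (f j) (V j)"
  shows "heat_ratio_limit l (\<lambda>i. \<Sum>j\<in>A. f j i) (\<Sum>j\<in>A. V j)"
  using assms
proof (induction A rule: infinite_finite_induct)
  case (insert j A)
  then show ?case using heat_ratio_limit_add[of l "f j" "V j"] by simp
qed (simp_all add: heat_ratio_limit_def exI[of _ "\<lambda>_. 0"] fps_tendsto_const)

text \<open>Multiplication of \<open>f\<close> by \<open>x - a\<close> becomes the operator \<open>x - a - D/d\<close>. On \<open>u Q\<close>, with \<open>Q\<close> the polynomial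
with zeros \<open>Z i\<close>, it gives \<open>((z - a - Q'/(d Q)) u - u'/d) Q\<close>. Here \<open>Q'/(d Q)\<close> tends to \<open>G\<close>, while \<open>u'\<close>
stays bounded coefficientwise, so that the last term vanishes in the limit. The factor obtained is
\<open>w (z - a - G)\<close>.\<close>
lemma heat_ratio_limit_linear_mult:
  assumes "heat_ratio_limit l f V"
  shows "heat_ratio_limit (Suc l) (\<lambda>i. [:- a, 1:] * f i) ((1 - fps_const a * fps_X - fps_X * G) * V)"
proof -
  obtain v where v: "fps_tendsto v V" and
    eq: "\<And>i. fls_X ^ l * poly_at_inv (heat (- 1 / real (d i)) (f i))
        = fps_to_fls (v i) * poly_at_inv (root_poly (Z i))"
    using assms unfolding heat_ratio_limit_def by blast
  \<comment> \<open>with \<open>u = w\<^sup>-\<^sup>l v\<close>, the term \<open>- w\<^sup>l\<^sup>+\<^sup>1 u'\<close> is \<open>w\<^sup>3 v' - l w\<^sup>2 v\<close>, as \<open>d/dz = - w\<^sup>2 d/dw\<close>\<close>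
  define v' where "v' i = (1 - fps_const a * fps_X - fps_X * moment_series (Z i)) * v i
      + fps_const (1 / real (d i)) * (fps_X ^ 3 * fps_deriv (v i) - fps_const (real l) * fps_X\<^sup>2 * v i)" for i
  have "fps_tendsto v' ((1 - fps_const a * fps_X - fps_X * G) * V
      + fps_const 0 * (fps_X ^ 3 * fps_deriv V - fps_const (real l) * fps_X\<^sup>2 * V))"
    unfolding v'_def
    by (intro fps_tendsto_add fps_tendsto_mult fps_tendsto_diff fps_tendsto_const fps_tendsto_deriv
        fps_tendsto_fps_const G v d_lim)
  moreover have "fls_X ^ Suc l * poly_at_inv (heat (- 1 / real (d i)) ([:- a, 1:] * f i))
        = fps_to_fls (v' i) * poly_at_inv (root_poly (Z i))" for i
  proof -
    define X :: "real fls" where "X = fls_X"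
    define Xi :: "real fls" where "Xi = fls_X_inv"
    define u where "u = poly_at_inv (heat (- 1 / real (d i)) (f i))"
    define \<Phi> where "\<Phi> = poly_at_inv (root_poly (Z i))"
    define s where "s = fls_const (1 / real (d i))"
    define w where "w = fps_to_fls (v i)"
    define g where "g = fps_to_fls (moment_series (Z i))"
    have XXi: "X * Xi = 1" by (simp add: X_def Xi_def fls_X_mult_X_inv)
    have uw: "X ^ l * u = w * \<Phi>" using eq[of i] by (simp only: X_def u_def w_def \<Phi>_def)
    have sN: "s * of_nat (d i) = 1"
      using d_pos[of i] by (simp add: s_def fls_of_nat fls_const_mult_const)
    have d\<Phi>: "X\<^sup>2 * fls_deriv \<Phi> = - (of_nat (d i) * g * \<Phi>)"
    proof -
      have "- (X\<^sup>2 * fls_deriv \<Phi>) = of_nat (d i) * g * \<Phi>"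
        using poly_at_inv_log_derivative[of "Z i"] poly_at_inv_pderiv[of "root_poly (Z i)"]
        by (simp only: \<Phi>_def g_def X_def size_Z)
      then show ?thesis by (metis minus_minus)
    qed
    have dX: "fls_deriv (X ^ l) * X = of_nat l * X ^ l"
      by (induction l) (simp_all add: X_def algebra_simps)
    have duw: "fls_deriv (X ^ l) * u + X ^ l * fls_deriv u = fls_deriv w * \<Phi> + w * fls_deriv \<Phi>"
      using arg_cong[OF uw, of fls_deriv] by (simp add: add.commute)
    have c: "fls_const (- 1 / real (d i)) = - s" "fls_const (- a) = - fls_const a"
      by (simp_all add: s_def)
    define y where "y = poly_at_inv (heat (- 1 / real (d i)) ([:- a, 1:] * f i))"
    have y: "y = (Xi - fls_const a) * u + s * (X\<^sup>2 * fls_deriv u)"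
      unfolding y_def heat_linear_mult mult_1_right poly_at_inv_add poly_at_inv_mult poly_at_inv_smult poly_at_inv_pderiv c
      by (simp add: u_def X_def Xi_def c algebra_simps)
    have "X ^ Suc l * y
        = (X * Xi - fls_const a * X) * (X ^ l * u) + s * X ^ 3 * (X ^ l * fls_deriv u)"
      unfolding y by (simp add: algebra_simps power2_eq_square power3_eq_cube)
    also have "X ^ l * fls_deriv u = fls_deriv w * \<Phi> + w * fls_deriv \<Phi> - fls_deriv (X ^ l) * u"
      using duw by (simp add: algebra_simps)
    also have "s * X ^ 3 * \<dots> = s * X ^ 3 * fls_deriv w * \<Phi> + s * X * w * (X\<^sup>2 * fls_deriv \<Phi>)
        - s * X\<^sup>2 * (fls_deriv (X ^ l) * X) * u"
      by (simp add: algebra_simps power2_eq_square power3_eq_cube)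
    also have "\<dots> = s * X ^ 3 * fls_deriv w * \<Phi> - (s * of_nat (d i)) * X * w * g * \<Phi>
        - s * X\<^sup>2 * of_nat l * (X ^ l * u)"
      unfolding d\<Phi> dX by (simp add: algebra_simps)
    finally have "X ^ Suc l * y
        = ((1 - fls_const a * X - X * g) * w + s * (X ^ 3 * fls_deriv w - of_nat l * X\<^sup>2 * w)) * \<Phi>"
      unfolding sN uw XXi by (simp add: algebra_simps)
    also have "(1 - fls_const a * X - X * g) * w + s * (X ^ 3 * fls_deriv w - of_nat l * X\<^sup>2 * w) = fps_to_fls (v' i)"
      by (simp add: v'_def X_def g_def w_def s_def fls_times_fps_to_fls
         fps_to_fls_power fls_deriv_fps_to_fls fls_of_nat)
    finally show ?thesis by (simp only: X_def \<Phi>_def y_def)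
  qed
  ultimately show ?thesis
    unfolding heat_ratio_limit_def by auto
qed

lemma heat_ratio_limit_prod_mult:
  assumes "finite A" "heat_ratio_limit l f V"
  shows "heat_ratio_limit (l + card A) (\<lambda>i. (\<Prod>j\<in>A. [:- a j, 1:]) * f i)
     ((\<Prod>j\<in>A. 1 - fps_const (a j) * fps_X - fps_X * G) * V)"
  using assms(1)
proof (induction A rule: finite_induct)
  case (insert j A)
  from heat_ratio_limit_linear_mult[OF insert.IH, of "a j"] show ?case
    by (simp only: prod.insert[OF insert.hyps] card_insert_disjoint[OF insert.hyps] add_Suc_right mult.assoc)
qed (use assms(2) in simp)

end


lemma linear_prod_mult_pderiv:
  fixes a :: "nat \<Rightarrow> real" and m :: "nat \<Rightarrow> nat"
  assumes "finite A"
  defines "P \<equiv> \<Prod>j\<in>A. [:- a j, 1:] ^ m j"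
  shows "(\<Prod>j\<in>A. [:- a j, 1:]) * pderiv P
     = (\<Sum>j\<in>A. smult (real (m j)) ((\<Prod>i\<in>A - {j}. [:- a i, 1:]) * P))"
proof -
  define L where "L j = [:- a j, 1:]" for j
  have P: "P = (\<Prod>j\<in>A. L j ^ m j)" by (simp add: P_def L_def)
  have pow: "L j * pderiv (L j ^ k) = smult (real k) (L j ^ k)" for j k
  proof (cases k)
    case (Suc k')
    have "pderiv (L j) = 1" by (simp add: L_def pderiv_pCons)
    then show ?thesis
      unfolding Suc pderiv_power_Suc by simp
  qed simp
  have "(\<Prod>j\<in>A. L j) * pderiv P = (\<Sum>j\<in>A. (\<Prod>j\<in>A. L j) * ((\<Prod>i\<in>A - {j}. L i ^ m i) * pderiv (L j ^ m j)))"
    by (simp only: P pderiv_prod sum_distrib_left)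
  also have "\<dots> = (\<Sum>j\<in>A. smult (real (m j)) ((\<Prod>i\<in>A - {j}. L i) * P))"
  proof (rule sum.cong[OF refl])
    fix j assume "j \<in> A"
    have "(\<Prod>j\<in>A. L j) * ((\<Prod>i\<in>A - {j}. L i ^ m i) * pderiv (L j ^ m j))
        = (\<Prod>i\<in>A - {j}. L i) * (\<Prod>i\<in>A - {j}. L i ^ m i) * (L j * pderiv (L j ^ m j))"
      by (simp only: prod.remove[OF assms(1) \<open>j \<in> A\<close>, of L] mult_ac)
    also have "\<dots> = smult (real (m j)) ((\<Prod>i\<in>A - {j}. L i) * (L j ^ m j * (\<Prod>i\<in>A - {j}. L i ^ m i)))"
      by (simp only: pow mult_smult_left mult_smult_right mult_ac)
    also have "L j ^ m j * (\<Prod>i\<in>A - {j}. L i ^ m i) = P"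
      using prod.remove[OF assms(1) \<open>j \<in> A\<close>, of "\<lambda>j. L j ^ m j"] by (simp only: P)
    finally show "(\<Prod>j\<in>A. L j) * ((\<Prod>i\<in>A - {j}. L i ^ m i) * pderiv (L j ^ m j))
        = smult (real (m j)) ((\<Prod>i\<in>A - {j}. L i) * P)" .
  qed
  finally show ?thesis by (simp only: L_def)
qed

lemma smult_sum_right: "smult c (\<Sum>j\<in>A. f j) = (\<Sum>j\<in>A. smult c (f j))"
  by (induction A rule: infinite_finite_induct) (simp_all add: smult_add_right)

text \<open>Clearing denominators in \<open>P'/P = \<Sum> m j/(x - a j)\<close> writes one polynomial in two ways, as a product of
linear factors with \<open>P'/d\<close> and as a sum of such products with \<open>P\<close>; the limit of its quotient computed
from either form is the same.\<close>
lemma (in heat_zeros) moment_series_equation: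
  fixes a :: "nat \<Rightarrow> real" and m :: "nat \<Rightarrow> nat \<Rightarrow> nat"
  assumes "finite A" and P: "\<And>i. P i = (\<Prod>j\<in>A. [:- a j, 1:] ^ m i j)"
    and q: "\<And>j. j \<in> A \<Longrightarrow> (\<lambda>i. real (m i j) / real (d i)) \<longlonglongrightarrow> q j"
  defines "U \<equiv> \<lambda>j. 1 - fps_const (a j) * fps_X - fps_X * G"
  shows "(\<Prod>j\<in>A. U j) * G = (\<Sum>j\<in>A. fps_const (q j) * (fps_X * (\<Prod>i\<in>A - {j}. U i)))"
proof (rule heat_ratio_limit_unique)
  show "heat_ratio_limit (card A) (\<lambda>i. (\<Prod>j\<in>A. [:- a j, 1:]) * smult (1 / real (d i)) (pderiv (P i)))
      ((\<Prod>j\<in>A. U j) * G)"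
    using heat_ratio_limit_prod_mult[OF assms(1) heat_ratio_limit_deriv, of a] by (simp add: U_def)
  have "heat_ratio_limit (card A)
      (\<lambda>i. \<Sum>j\<in>A. smult (real (m i j) / real (d i)) ((\<Prod>i\<in>A - {j}. [:- a i, 1:]) * P i))
      (\<Sum>j\<in>A. fps_const (q j) * (fps_X * (\<Prod>i\<in>A - {j}. U i)))"
  proof (intro heat_ratio_limit_sum heat_ratio_limit_smult q)
    fix j assume "j \<in> A"
    have "heat_ratio_limit (Suc (0 + card (A - {j}))) (\<lambda>i. (\<Prod>i\<in>A - {j}. [:- a i, 1:]) * P i)
        (fps_X * ((\<Prod>i\<in>A - {j}. 1 - fps_const (a i) * fps_X - fps_X * G) * 1))"
      by (intro heat_ratio_limit_shift heat_ratio_limit_prod_mult heat_ratio_limit_P finite_Diff assms(1))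
    moreover have "Suc (0 + card (A - {j})) = card A"
      using card.remove[OF assms(1) \<open>j \<in> A\<close>] by simp
    ultimately show "heat_ratio_limit (card A) (\<lambda>i. (\<Prod>i\<in>A - {j}. [:- a i, 1:]) * P i)
        (fps_X * (\<Prod>i\<in>A - {j}. U i))"
      by (simp only: U_def mult_1_right)
  qed
  moreover have "(\<Sum>j\<in>A. smult (real (m i j) / real (d i)) ((\<Prod>i\<in>A - {j}. [:- a i, 1:]) * P i))
      = (\<Prod>j\<in>A. [:- a j, 1:]) * smult (1 / real (d i)) (pderiv (P i))" for i
    unfolding P mult_smult_right linear_prod_mult_pderiv[OF assms(1)] smult_sum_right smult_smult
    by (intro sum.cong refl arg_cong2[where f = smult]) simp
  ultimately show "heat_ratio_limit (card A) (\<lambda>i. (\<Prod>j\<in>A. [:- a j, 1:]) * smult (1 / real (d i)) (pderiv (P i)))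
      (\<Sum>j\<in>A. fps_const (q j) * (fps_X * (\<Prod>i\<in>A - {j}. U i)))"
    by (simp only:)
qed

section \<open>Subordination and the R-transform\<close>

text \<open>Dividing by the product of the \<open>U j\<close> gives \<open>G = \<Sum> q j w / (1 - a j w - w G)\<close>. With
\<open>W = w / (1 - w G)\<close>, the series of \<open>1/(z - G)\<close>, each summand is \<open>q j W / (1 - a j W)\<close>.\<close>
lemma subordination:
  fixes G :: "real fps" and a q :: "nat \<Rightarrow> real"
  assumes "finite A"
  defines "U \<equiv> \<lambda>j. 1 - fps_const (a j) * fps_X - fps_X * G"
  defines "W \<equiv> fps_X * inverse (1 - fps_X * G)"
  assumes eq: "(\<Prod>j\<in>A. U j) * G = (\<Sum>j\<in>A. fps_const (q j) * (fps_X * (\<Prod>i\<in>A - {j}. U i)))"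
  shows "G = (\<Sum>j\<in>A. fps_const (q j) * (fps_X * Abs_fps (\<lambda>k. a j ^ k))) oo W"
proof -
  define Y where "Y j = W * (Abs_fps (\<lambda>k. a j ^ k) oo W)" for j
  have W0: "W $ 0 = 0" by (simp add: W_def)
  have W: "W * (1 - fps_X * G) = fps_X"
    by (simp add: W_def mult.assoc inverse_mult_eq_1)
  have YU: "Y j * U j = fps_X" for j
  proof -
    have "(Abs_fps (\<lambda>k. a j ^ k) * (1 - fps_const (a j) * fps_X)) oo W = 1 oo W"
      by (simp only: geometric_fps)
    then have geo: "(Abs_fps (\<lambda>k. a j ^ k) oo W) * (1 - fps_const (a j) * W) = 1"
      using W0 by (simp add: fps_compose_mult_distrib fps_compose_sub_distrib fps_const_compose)
    have U: "U j = (1 - fps_const (a j) * W) * (1 - fps_X * G)"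
    proof -
      have "(1 - fps_const (a j) * W) * (1 - fps_X * G)
          = (1 - fps_X * G) - fps_const (a j) * (W * (1 - fps_X * G))"
        by (simp add: algebra_simps)
      then show ?thesis unfolding W by (simp add: U_def algebra_simps)
    qed
    have "(Abs_fps (\<lambda>k. a j ^ k) oo W) * U j = 1 - fps_X * G"
      by (simp only: U geo mult.assoc[symmetric] mult_1_left)
    then show ?thesis
      using W by (simp add: Y_def mult.assoc)
  qed
  have "(\<Prod>j\<in>A. U j) * G = (\<Sum>j\<in>A. fps_const (q j) * Y j) * (\<Prod>j\<in>A. U j)"
    unfolding eq sum_distrib_right
  proof (rule sum.cong[OF refl])
    fix j assume "j \<in> A"
    show "fps_const (q j) * (fps_X * (\<Prod>i\<in>A - {j}. U i)) = fps_const (q j) * Y j * (\<Prod>j\<in>A. U j)"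
      using YU[of j] by (simp add: prod.remove[OF assms(1) \<open>j \<in> A\<close>] mult.assoc flip: mult.assoc[of "Y j"])
  qed
  moreover have "(\<Prod>j\<in>A. U j) \<noteq> 0"
  proof -
    have "U j \<noteq> 0" for j
    proof
      assume "U j = 0"
      then have "U j $ 0 = 0" by simp
      then show False by (simp add: U_def)
    qed
    then show ?thesis using assms(1) by simp
  qed
  ultimately have "G = (\<Sum>j\<in>A. fps_const (q j) * Y j)"
    by (simp add: mult.commute)
  then show ?thesis
    using W0 by (simp add: Y_def fps_compose_sum_distrib fps_compose_mult_distrib fps_const_compose)
qed

lemma fps_inv_unique:
  fixes f g :: "real fps"
  assumes "f $ 0 = 0" "f $ 1 \<noteq> 0" "g $ 0 = 0" "f oo g = fps_X"
  shows "g = fps_inv f"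
proof -
  have "(fps_inv f oo f) oo g = fps_X oo g"
    by (simp only: fps_inv[OF assms(1,2)])
  moreover have "(fps_inv f oo f) oo g = fps_inv f oo (f oo g)"
    using assms by (intro fps_compose_assoc[symmetric]) auto
  ultimately show ?thesis using assms by simp
qed

text \<open>Substituting the inverse series \<open>I\<close> of \<open>G\<close> into \<open>G = C \<circ> (w / (1 - w G))\<close> shows that the inverse of
\<open>C\<close> is \<open>I / (1 - w I)\<close>. In terms of \<open>K = 1/I\<close> this says that the two functions \<open>K\<close> differ by \<open>w\<close>.\<close>
lemma fps_inv_subordinate:
  fixes G C :: "real fps"
  assumes G: "G $ 0 = 0" "G $ 1 \<noteq> 0" and C: "C $ 0 = 0" "C $ 1 \<noteq> 0"
    and sub: "G = C oo (fps_X * inverse (1 - fps_X * G))"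
  shows "fps_inv C * (1 - fps_X * fps_inv G) = fps_inv G"
proof -
  define W where "W = fps_X * inverse (1 - fps_X * G)"
  define I where "I = fps_inv G"
  have I0: "I $ 0 = 0" by (simp add: I_def fps_inv_def)
  have GI: "G oo I = fps_X" using G by (simp add: I_def fps_inv_right)
  have W: "W * (1 - fps_X * G) = fps_X"
    by (simp add: W_def mult.assoc inverse_mult_eq_1)
  have "C oo (W oo I) = fps_X"
    using sub GI I0 C by (simp add: W_def fps_compose_assoc)
  then have "W oo I = fps_inv C"
    using C I0 by (intro fps_inv_unique) (simp_all add: W_def)
  moreover have "(W oo I) * (1 - I * fps_X) = I"
    using arg_cong[OF W, of "\<lambda>f. f oo I"] I0 GI
    by (simp add: fps_compose_mult_distrib fps_compose_sub_distrib)
  ultimately show ?thesis by (simp add: I_def mult.commute)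
qed

section \<open>The R-transform of the semicircle distribution\<close>

lemma semicircle_moment:
  "(LINT x|semicircle. x ^ k) = 1 / (2 * pi) * integral {-2..2} (\<lambda>x. x ^ k * sqrt (4 - x\<^sup>2))"
proof -
  have "(LINT x|semicircle. x ^ k)
      = (LINT x|lborel. (1 / (2 * pi) * sqrt (4 - x\<^sup>2) * indicator {-2..2} x) *\<^sub>R x ^ k)"
    unfolding semicircle_def
  proof (rule integral_density)
    show "AE x in lborel. 0 \<le> 1 / (2 * pi) * sqrt (4 - x\<^sup>2) * indicator {- 2..2} x"
    proof (rule AE_I2)
      fix x :: real
      have "0 \<le> 4 - x\<^sup>2" if "x \<in> {-2..2}"
        using that abs_le_square_iff[of x 2] by auto
      then show "0 \<le> 1 / (2 * pi) * sqrt (4 - x\<^sup>2) * indicator {- 2..2} x"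
        by (cases "x \<in> {-2..2}") simp_all
    qed
  qed measurable
  also have "\<dots> = 1 / (2 * pi) * (LINT x|lborel. indicator {-2..2} x *\<^sub>R (x ^ k * sqrt (4 - x\<^sup>2)))"
    unfolding integral_mult_right_zero[symmetric] by (intro Bochner_Integration.integral_cong) simp_all
  also have "(LINT x|lborel. indicator {-2..2} x *\<^sub>R (x ^ k * sqrt (4 - x\<^sup>2)))
      = integral {-2..2} (\<lambda>x. x ^ k * sqrt (4 - x\<^sup>2))"
  proof -
    have "set_integrable lborel {-2..2} (\<lambda>x::real. x ^ k * sqrt (4 - x\<^sup>2))"
      by (intro borel_integrable_atLeastAtMost' continuous_intros)
    from set_borel_integral_eq_integral(2)[OF this] show ?thesis
      by (simp add: set_lebesgue_integral_def)
  qed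
  finally show ?thesis .
qed

lemma semicircle_density_deriv:
  assumes "x \<in> {-2<..<2}"
  shows "0 < sqrt (4 - x\<^sup>2)" "sqrt (4 - x\<^sup>2) * sqrt (4 - x\<^sup>2) = 4 - x\<^sup>2"
    and "((\<lambda>x. sqrt (4 - x\<^sup>2)) has_field_derivative - x / sqrt (4 - x\<^sup>2)) (at x)"
proof -
  have pos: "0 < 4 - x\<^sup>2"
    using assms abs_square_less_1[of "x / 2"] by (auto simp: power_divide)
  then show "0 < sqrt (4 - x\<^sup>2)" "sqrt (4 - x\<^sup>2) * sqrt (4 - x\<^sup>2) = 4 - x\<^sup>2"
    by simp_all
  show "((\<lambda>x. sqrt (4 - x\<^sup>2)) has_field_derivative - x / sqrt (4 - x\<^sup>2)) (at x)"
    using pos by (auto intro!: derivative_eq_intros simp: field_simps)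
qed

text \<open>The derivative of \<open>x\<^sup>k\<^sup>+\<^sup>1 (4 - x\<^sup>2)\<^sup>3\<^sup>/\<^sup>2\<close> is the difference of the two integrands, and this function vanishes
at both end points.\<close>
lemma semicircle_integral_recursion:
  "integral {-2..2} (\<lambda>x. x ^ Suc (Suc k) * sqrt (4 - x\<^sup>2)) * (real k + 4)
     = integral {-2..2} (\<lambda>x. x ^ k * sqrt (4 - x\<^sup>2)) * (4 * (real k + 1))"
proof -
  define s where "s x = sqrt (4 - x\<^sup>2)" for x :: real
  let ?I = "\<lambda>k. integral {-2..2} (\<lambda>x. x ^ k * s x)"
  have s_cont: "continuous_on {-2..2} s"
    unfolding s_def[abs_def] by (intro continuous_intros)
  have int: "(\<lambda>x. x ^ j * s x) integrable_on {-2..2::real}" for j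
    by (intro integrable_continuous_interval continuous_intros s_cont)
  let ?F = "\<lambda>x::real. x ^ Suc k * ((4 - x\<^sup>2) * s x)"
  let ?f = "\<lambda>x::real. x ^ k * s x * (4 * (real k + 1)) - x ^ Suc (Suc k) * s x * (real k + 4)"
  have "(?f has_integral ?F 2 - ?F (-2)) {-2..2}"
  proof (rule fundamental_theorem_of_calculus_interior)
    show "continuous_on {-2..2} ?F" by (intro continuous_intros s_cont)
    fix x :: real assume x: "x \<in> {-2<..<2}"
    note s = semicircle_density_deriv[OF x, folded s_def]
    have s': "((4 - x\<^sup>2)) * (- x / s x) = - x * s x"
      unfolding s(2)[symmetric] using s(1) by simp
    have "(?F has_field_derivative
        (real (Suc k) * x ^ k) * ((4 - x\<^sup>2) * s x) + x ^ Suc k * ((4 - x\<^sup>2) * (- x / s x) + (- (2 * x)) * s x)) (at x)"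
      by (auto intro!: derivative_eq_intros s(3) simp: algebra_simps simp del: power_Suc)
    moreover have "(real (Suc k) * x ^ k) * ((4 - x\<^sup>2) * s x) + x ^ Suc k * ((4 - x\<^sup>2) * (- x / s x) + (- (2 * x)) * s x) = ?f x"
      unfolding s' by (simp add: algebra_simps power2_eq_square)
    ultimately show "(?F has_vector_derivative ?f x) (at x)"
      by (simp only: has_real_derivative_iff_has_vector_derivative)
  qed simp
  moreover have "?F 2 - ?F (-2) = 0" by simp
  ultimately have "integral {-2..2} ?f = 0"
    by (simp only: integral_unique)
  moreover have "integral {-2..2} ?f = ?I k * (4 * (real k + 1)) - ?I (Suc (Suc k)) * (real k + 4)"
  proof -
    have "integral {-2..2} ?f = integral {-2..2} (\<lambda>x. x ^ k * s x * (4 * (real k + 1)))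
        - integral {-2..2} (\<lambda>x. x ^ Suc (Suc k) * s x * (real k + 4))"
      by (intro Henstock_Kurzweil_Integration.integral_diff integrable_on_mult_left int)
    then show ?thesis
      by (simp only: Henstock_Kurzweil_Integration.integral_mult_left)
  qed
  ultimately show ?thesis unfolding s_def by linarith
qed

lemma semicircle_integral_0: "integral {-2..2} (\<lambda>x::real. sqrt (4 - x\<^sup>2)) = 2 * pi"
proof -
  define s where "s x = sqrt (4 - x\<^sup>2)" for x :: real
  define A where "A = (\<lambda>x::real. arcsin (x / 2))"
  let ?F = "\<lambda>x::real. x * s x / 2 + 2 * A x"
  have "(s has_integral ?F 2 - ?F (-2)) {-2..2}"
  proof (rule fundamental_theorem_of_calculus_interior)
    show "continuous_on {-2..2} ?F" unfolding s_def[abs_def] A_def by (intro continuous_intros) auto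
    fix x :: real assume x: "x \<in> {-2<..<2}"
    note s = semicircle_density_deriv[OF x, folded s_def]
    have "sqrt (1 - (x / 2)\<^sup>2) = s x / 2"
    proof -
      have "sqrt (1 - (x / 2)\<^sup>2) = sqrt ((4 - x\<^sup>2) / 4)" by (simp add: power_divide diff_divide_distrib)
      then show ?thesis by (simp only: s_def real_sqrt_divide real_sqrt_four)
    qed
    then have A': "(A has_field_derivative 1 / s x) (at x)"
      unfolding A_def using x by (auto intro!: derivative_eq_intros simp: divide_simps)
    have "(?F has_field_derivative (s x + x * (- x / s x)) / 2 + 2 * (1 / s x)) (at x)"
      by (auto intro!: derivative_eq_intros s(3) A')
    moreover have "(s x + x * (- x / s x)) / 2 + 2 * (1 / s x) = s x"
      using s(1,2) by (simp add: field_simps power2_eq_square)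
    ultimately show "(?F has_vector_derivative s x) (at x)"
      by (simp only: has_real_derivative_iff_has_vector_derivative)
  qed simp
  moreover have "?F 2 - ?F (-2) = 2 * pi" by (simp add: s_def A_def)
  ultimately show ?thesis unfolding s_def[abs_def] by (simp only: integral_unique)
qed

lemma semicircle_integral_1: "integral {-2..2} (\<lambda>x::real. x * sqrt (4 - x\<^sup>2)) = 0"
proof -
  define s where "s x = sqrt (4 - x\<^sup>2)" for x :: real
  let ?F = "\<lambda>x::real. - (1 / 3) * ((4 - x\<^sup>2) * s x)"
  have "((\<lambda>x. x * s x) has_integral ?F 2 - ?F (-2)) {-2..2}"
  proof (rule fundamental_theorem_of_calculus_interior)
    show "continuous_on {-2..2} ?F" unfolding s_def[abs_def] by (intro continuous_intros)
    fix x :: real assume x: "x \<in> {-2<..<2}"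
    note s = semicircle_density_deriv[OF x, folded s_def]
    have s': "((4 - x\<^sup>2)) * (- x / s x) = - x * s x"
      unfolding s(2)[symmetric] using s(1) by simp
    have "(?F has_field_derivative - (1 / 3) * ((4 - x\<^sup>2) * (- x / s x) + (- (2 * x)) * s x)) (at x)"
      by (auto intro!: derivative_eq_intros s(3))
    moreover have "- (1 / 3) * ((4 - x\<^sup>2) * (- x / s x) + (- (2 * x)) * s x) = x * s x"
      unfolding s' by simp
    ultimately show "(?F has_vector_derivative x * s x) (at x)"
      by (simp only: has_real_derivative_iff_has_vector_derivative)
  qed simp
  moreover have "?F 2 - ?F (-2) = 0" by simp
  ultimately show ?thesis unfolding s_def by (simp only: integral_unique)
qed

text \<open>The recursion is the differential equation \<open>D S' = -4 x S\<close> for \<open>S = 1 - 2 x\<^sup>2 M\<close> and \<open>D = 1 - 4 x\<^sup>2\<close>. As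
\<open>D' = -8 x\<close>, the quotient \<open>S\<^sup>2 / D\<close> is constant, which means \<open>S = \<surd>D\<close>; the claim is \<open>S\<^sup>2 = D\<close> written out.\<close>
lemma catalan_series_quadratic:
  fixes M :: "real fps"
  assumes M0: "M $ 0 = 1" and M1: "M $ 1 = 0"
    and rec: "\<And>k. M $ (k + 2) * (real k + 4) = M $ k * (4 * (real k + 1))"
  shows "M = 1 + (fps_X * M)\<^sup>2"
proof -
  have "fps_X * fps_deriv M + 2 * M - 2 = 4 * (fps_X\<^sup>2 * (fps_X * fps_deriv M + M))"
  proof (rule fps_ext)
    fix k :: nat
    show "fps_nth (fps_X * fps_deriv M + 2 * M - 2) k = fps_nth (4 * (fps_X\<^sup>2 * (fps_X * fps_deriv M + M))) k"
    proof (cases k)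
      case 0
      then show ?thesis by (simp add: M0 fps_X_power_mult_nth numeral_fps_const)
    next
      case (Suc i)
      show ?thesis
      proof (cases i)
        case 0
        then show ?thesis using M1 by (simp add: Suc fps_X_power_mult_nth numeral_fps_const)
      next
        case (Suc j)
        then have k: "k = j + 2" using \<open>k = Suc i\<close> by simp
        have "fps_nth (fps_X * fps_deriv M + M) j = (real j + 1) * fps_nth M j"
          by (cases j) (simp_all add: algebra_simps)
        then have "fps_nth (4 * (fps_X\<^sup>2 * (fps_X * fps_deriv M + M))) k = 4 * ((real j + 1) * fps_nth M j)"
          unfolding k by (simp add: fps_X_power_mult_nth numeral_fps_const)
        moreover have "fps_nth (fps_X * fps_deriv M + 2 * M - 2) k = fps_nth M (j + 2) * (real j + 4)"
          unfolding k by (simp add: numeral_fps_const distrib_left mult_ac)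
        ultimately show ?thesis using rec[of j] by (simp only: mult_ac)
      qed
    qed
  qed
  then have ode: "(1 - 4 * fps_X\<^sup>2) * (fps_X * fps_deriv M) = 2 - (2 - 4 * fps_X\<^sup>2) * M"
    by (simp add: algebra_simps)
  define D :: "real fps" where "D = 1 - 4 * fps_X\<^sup>2"
  define S where "S = 1 - 2 * (fps_X\<^sup>2 * M)"
  have dD: "fps_deriv D = - (8 * fps_X)"
    by (simp add: D_def power2_eq_square)
  have "D * fps_deriv S = - (4 * fps_X * M * D) - 2 * fps_X * (D * (fps_X * fps_deriv M))"
    by (simp add: S_def algebra_simps power2_eq_square)
  also have "D * (fps_X * fps_deriv M) = 2 - (2 - 4 * fps_X\<^sup>2) * M"
    using ode by (simp add: D_def)
  finally have DS: "D * fps_deriv S = - (4 * fps_X * S)"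
    by (simp add: D_def S_def algebra_simps power2_eq_square)
  have D0: "D $ 0 = 1" by (simp add: D_def)
  have "fps_deriv (S\<^sup>2 * inverse D) = 0"
  proof -
    have "fps_deriv (S\<^sup>2 * inverse D) = 2 * S * fps_deriv S * inverse D - S\<^sup>2 * fps_deriv D * (inverse D)\<^sup>2"
      using D0 by (simp add: fps_inverse_deriv power2_eq_square algebra_simps)
    also have "2 * S * fps_deriv S * inverse D = 2 * S * (D * fps_deriv S) * (inverse D)\<^sup>2"
    proof -
      have "D * inverse D = 1" using D0 by (simp add: inverse_mult_eq_1')
      then show ?thesis by (simp add: power2_eq_square mult_ac)
    qed
    finally show ?thesis
      unfolding DS dD by (simp add: power2_eq_square algebra_simps)
  qed
  then have "S\<^sup>2 * inverse D = fps_const ((S\<^sup>2 * inverse D) $ 0)"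
    by (simp only: fps_deriv_eq_0_iff)
  also have "(S\<^sup>2 * inverse D) $ 0 = 1"
    using D0 by (simp add: S_def power2_eq_square)
  finally have "S\<^sup>2 * (inverse D * D) = D"
    by (metis fps_const_1_eq_1 mult.assoc mult_1_left)
  then have "S\<^sup>2 = D"
    using D0 by (simp add: inverse_mult_eq_1)
  then have "4 * fps_X\<^sup>2 * (1 + (fps_X * M)\<^sup>2 - M) = 0"
    by (simp add: S_def D_def power2_eq_square algebra_simps)
  then show ?thesis by simp
qed

lemma cauchy_series_semicircle:
  "cauchy_series semicircle = fps_X * (1 + (cauchy_series semicircle)\<^sup>2)"
proof -
  let ?I = "\<lambda>k. integral {-2..2} (\<lambda>x::real. x ^ k * sqrt (4 - x\<^sup>2))"
  define M where "M = Abs_fps (\<lambda>k. LINT x|semicircle. x ^ k)"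
  have M: "M $ k = 1 / (2 * pi) * ?I k" for k
    unfolding M_def fps_nth_Abs_fps by (rule semicircle_moment)
  have "M = 1 + (fps_X * M)\<^sup>2"
  proof (rule catalan_series_quadratic)
    show "M $ 0 = 1" using semicircle_integral_0 by (simp add: M)
    show "M $ 1 = 0" using semicircle_integral_1 by (simp add: M)
    show "M $ (k + 2) * (real k + 4) = M $ k * (4 * (real k + 1))" for k
      using semicircle_integral_recursion[of k] unfolding M mult.assoc by (simp only: add_2_eq_Suc')
  qed
  then show ?thesis
    unfolding cauchy_series_def M_def[symmetric] by (simp only:)
qed

lemma inverse_joukowski:
  fixes i x :: "'a::field"
  assumes "i * (1 + x\<^sup>2) = x" "x \<noteq> 0" "i \<noteq> 0"
  shows "inverse i = 1 / x + x"
  using assms by (simp add: field_simps power2_eq_square)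

text \<open>The quadratic equation \<open>C = w (1 + C\<^sup>2)\<close> inverts to \<open>w / (1 + w\<^sup>2)\<close>, so that \<open>K = 1/w + w\<close>.\<close>
lemma R_transform_semicircle: "R_transform semicircle = fls_X"
proof -
  let ?C = "cauchy_series semicircle"
  define I where "I = fps_inv ?C"
  have C0: "?C $ 0 = 0" by (simp add: cauchy_series_def)
  have "?C $ 1 = (fps_X * (1 + ?C\<^sup>2)) $ 1"
    using cauchy_series_semicircle by (rule arg_cong)
  also have "\<dots> = 1"
    using C0 by (simp add: power2_eq_square)
  finally have C1: "?C $ 1 = 1" .
  have I0: "I $ 0 = 0" by (simp add: I_def fps_inv_def)
  have CI: "?C oo I = fps_X"
    using C0 C1 by (simp add: I_def fps_inv_right)
  have "?C oo I = I * (1 + fps_X\<^sup>2)"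
    using arg_cong[OF cauchy_series_semicircle, of "\<lambda>f. f oo I"] I0 CI
    by (simp add: fps_compose_mult_distrib fps_compose_add_distrib power2_eq_square)
  then have I: "I * (1 + fps_X\<^sup>2) = fps_X" using CI by simp
  have "fps_to_fls I * fps_to_fls (1 + fps_X\<^sup>2) = fps_to_fls fps_X"
    by (simp only: fls_times_fps_to_fls[symmetric] I)
  then have "fps_to_fls I * (1 + fls_X\<^sup>2) = fls_X"
    by (simp add: fps_to_fls_power)
  moreover have "fls_X \<noteq> (0 :: real fls)" by (metis fps_X_to_fls fps_X_neq_zero fps_to_fls_eq_0_iff)
  moreover have "I \<noteq> 0" using I by auto
  ultimately have "inverse (fps_to_fls I) = 1 / fls_X + fls_X"
    by (intro inverse_joukowski) simp_all
  then show ?thesis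
    by (simp add: R_transform_def K_series_def I_def)
qed

section \<open>Moments of compactly supported measures\<close>

lemma integral_pmf_of_multiset:
  fixes f :: "'a \<Rightarrow> real"
  assumes "Z \<noteq> {#}"
  shows "(LINT x|measure_pmf (pmf_of_multiset Z). f x) = (\<Sum>x\<in>#Z. f x) / size Z"
proof -
  have "(LINT x|measure_pmf (pmf_of_multiset Z). f x) = (\<Sum>x\<in>set_mset Z. f x * (count Z x / size Z))"
    using assms by (subst integral_measure_pmf_real[of "set_mset Z"]) auto
  also have "\<dots> = (\<Sum>x\<in>set_mset Z. real (count Z x) * f x) / size Z"
    by (simp add: sum_divide_distrib mult_ac)
  also have "(\<Sum>x\<in>set_mset Z. real (count Z x) * f x) = (\<Sum>x\<in>#Z. f x)"
  proof (induction Z)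
    case (add y Z)
    have "(\<Sum>x\<in>set_mset (add_mset y Z). real (count (add_mset y Z) x) * f x)
        = (\<Sum>x\<in>insert y (set_mset Z). real (count Z x) * f x + (if x = y then f x else 0))"
      by (intro sum.cong) (auto simp: algebra_simps)
    also have "\<dots> = (\<Sum>x\<in>insert y (set_mset Z). real (count Z x) * f x) + f y"
      by (simp add: sum.distrib)
    also have "(\<Sum>x\<in>insert y (set_mset Z). real (count Z x) * f x) = (\<Sum>x\<in>set_mset Z. real (count Z x) * f x)"
      by (intro sum.mono_neutral_right) (auto simp: not_in_iff)
    finally show ?case using add by simp
  qed simp
  finally show ?thesis .
qed

definition empirical :: "real multiset \<Rightarrow> real measure" where
  "empirical Z = distr (measure_pmf (pmf_of_multiset Z)) borel (\<lambda>x. x)"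

lemma real_distribution_empirical: "real_distribution (empirical Z)"
  unfolding empirical_def by (rule prob_space.real_distribution_distr[OF prob_space_measure_pmf]) simp

lemma integral_empirical:
  fixes f :: "real \<Rightarrow> real"
  assumes "Z \<noteq> {#}" "f \<in> borel_measurable borel"
  shows "integral\<^sup>L (empirical Z) f = (\<Sum>x\<in>#Z. f x) / size Z"
  using assms by (simp add: empirical_def integral_distr integral_pmf_of_multiset)

lemma AE_empirical:
  assumes "Z \<noteq> {#}" "\<And>x. x \<in># Z \<Longrightarrow> \<bar>x\<bar> \<le> B"
  shows "AE x in empirical Z. \<bar>x\<bar> \<le> B"
proof -
  have "Measurable.pred borel (\<lambda>x::real. \<bar>x\<bar> \<le> B)" by measurable
  then show ?thesis
    unfolding empirical_def using assms by (subst AE_distr_iff) (auto simp: AE_measure_pmf_iff)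
qed

lemma cauchy_series_empirical:
  assumes "Z \<noteq> {#}"
  shows "cauchy_series (empirical Z) = moment_series Z"
  using assms by (simp add: cauchy_series_def moment_series_def integral_empirical)

text \<open>The characteristic function is the sum of its moment series, because the \<open>n\<close>-th moment grows at most
like \<open>B\<^sup>n\<close>.\<close>
lemma bounded_moments_unique:
  assumes M: "real_distribution M" "AE x in M. \<bar>x\<bar> \<le> B" and L: "real_distribution L" "AE x in L. \<bar>x\<bar> \<le> B"
    and moments: "\<And>k. (LINT x|M. x ^ k) = (LINT x|L. x ^ k)"
  shows "M = L"
proof (rule Levy_uniqueness[OF M(1) L(1)], rule ext)
  fix t
  have key: "cmod (char P t - (\<Sum>k\<le>n. ((\<i> * t)^k / fact k) * (LINT x|P. x ^ k))) \<le> 2 * (inverse (fact n) * \<bar>t * B\<bar> ^ n)"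
    if P: "real_distribution P" "AE x in P. \<bar>x\<bar> \<le> B" for P n
  proof -
    interpret P: real_distribution P by fact
    have bound: "AE x in P. \<bar>x\<bar> ^ k \<le> \<bar>B\<bar> ^ k" for k
      using P(2) by eventually_elim (auto intro: power_mono)
    have int: "integrable P (\<lambda>x. x ^ k)" for k
      by (rule P.integrable_const_bound[where B = "\<bar>B\<bar> ^ k"]) (use bound[of k] in \<open>auto simp: power_abs\<close>)
    have "P.expectation (\<lambda>x. \<bar>x\<bar> ^ n) \<le> P.expectation (\<lambda>x. \<bar>B\<bar> ^ n)"
      by (rule integral_mono_AE) (use int[of n, THEN integrable_abs] bound in \<open>auto simp: power_abs\<close>)
    then have E: "P.expectation (\<lambda>x. \<bar>x\<bar> ^ n) \<le> \<bar>B\<bar> ^ n"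
      using P.prob_space by simp
    have "cmod (char P t - (\<Sum>k\<le>n. ((\<i> * t)^k / fact k) * (LINT x|P. x ^ k)))
        \<le> (2 * \<bar>t\<bar> ^ n / fact n) * P.expectation (\<lambda>x. \<bar>x\<bar> ^ n)"
      by (rule P.char_approx1) (rule int)
    also have "\<dots> \<le> (2 * \<bar>t\<bar> ^ n / fact n) * \<bar>B\<bar> ^ n"
      by (intro mult_left_mono E) simp
    finally show ?thesis
      by (simp add: abs_mult power_mult_distrib field_simps)
  qed
  have "cmod (char M t - char L t) \<le> 4 * (inverse (fact n) * \<bar>t * B\<bar> ^ n)" for n
  proof -
    define S where "S = (\<Sum>k\<le>n. ((\<i> * t)^k / fact k) * (LINT x|L. x ^ k))"
    have "cmod (char M t - S) \<le> 2 * (inverse (fact n) * \<bar>t * B\<bar> ^ n)"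
      using key[OF M, of n] by (simp only: S_def moments)
    moreover have "cmod (char L t - S) \<le> 2 * (inverse (fact n) * \<bar>t * B\<bar> ^ n)"
      using key[OF L, of n] by (simp only: S_def)
    moreover have "cmod (char M t - char L t) \<le> cmod (char M t - S) + cmod (char L t - S)"
      using norm_triangle_ineq4[of "char M t - S" "char L t - S"] by simp
    ultimately show ?thesis by linarith
  qed
  moreover have "(\<lambda>n. 4 * (inverse (fact n) * \<bar>t * B\<bar> ^ n)) \<longlonglongrightarrow> 4 * 0"
    by (intro tendsto_mult tendsto_const summable_LIMSEQ_zero summable_exp)
  ultimately have "cmod (char M t - char L t) \<le> 4 * 0"
    by (intro LIMSEQ_le_const) blast+
  then show "char M t = char L t" by simp
qed

lemma compactly_supported_prob_iff:
  "compactly_supported_prob M \<longleftrightarrow> real_distribution M \<and> (\<exists>B. AE x in M. \<bar>x\<bar> \<le> B)"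
proof
  assume M: "compactly_supported_prob M"
  then interpret real_distribution M
    by (auto simp: compactly_supported_prob_def real_distribution_def real_distribution_axioms_def)
  obtain K where K: "compact K" "emeasure M (- K) = 0"
    using M by (auto simp: compactly_supported_prob_def)
  then obtain B where B: "\<And>x. x \<in> K \<Longrightarrow> \<bar>x\<bar> \<le> B"
    using compact_imp_bounded[of K] by (auto simp: bounded_iff)
  have "AE x in M. \<bar>x\<bar> \<le> B"
    by (rule AE_I[of _ _ "- K"]) (use K B compact_imp_closed[of K] in \<open>auto simp: borel_comp borel_closed\<close>)
  then show "real_distribution M \<and> (\<exists>B. AE x in M. \<bar>x\<bar> \<le> B)"
    using real_distribution_axioms by blast
next
  assume *: "real_distribution M \<and> (\<exists>B. AE x in M. \<bar>x\<bar> \<le> B)"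
  then interpret real_distribution M by blast
  obtain B where B: "AE x in M. \<bar>x\<bar> \<le> B" using * by blast
  have eq: "{x \<in> space M. \<not> \<bar>x\<bar> \<le> B} = - {-B..B}" by auto
  have "emeasure M (- {-B..B}) = 0"
    using B by (subst (asm) AE_iff_measurable[OF _ eq]) auto
  then show "compactly_supported_prob M"
    unfolding compactly_supported_prob_def using prob_space_axioms
    by (auto intro!: exI[of _ "{-B..B}"])
qed

lemma compactly_supported_moments_unique:
  assumes "compactly_supported_prob M" "compactly_supported_prob L"
    and "cauchy_series M = cauchy_series L"
  shows "M = L"
proof -
  from assms(1,2) obtain B C where
    M: "real_distribution M" "AE x in M. \<bar>x\<bar> \<le> B" and L: "real_distribution L" "AE x in L. \<bar>x\<bar> \<le> C"
    unfolding compactly_supported_prob_iff by blast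
  have moments: "(LINT x|M. x ^ k) = (LINT x|L. x ^ k)" for k
    using arg_cong[OF assms(3), of "\<lambda>f. fps_nth f (Suc k)"] by (simp add: cauchy_series_def)
  have "AE x in M. \<bar>x\<bar> \<le> max B C" using M(2) by eventually_elim simp
  moreover have "AE x in L. \<bar>x\<bar> \<le> max B C" using L(2) by eventually_elim simp
  ultimately show ?thesis
    using bounded_moments_unique M(1) L(1) moments by blast
qed

lemma R_transform_inj:
  assumes "compactly_supported_prob M" "compactly_supported_prob L" "R_transform M = R_transform L"
  shows "M = L"
proof (rule compactly_supported_moments_unique[OF assms(1,2)])
  have *: "fps_inv (fps_inv (cauchy_series P)) = cauchy_series P" if "prob_space P" for P
    using that by (intro fps_inv_idempotent) (simp_all add: cauchy_series_def prob_space.prob_space)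
  have "K_series M = K_series L"
    using assms(3) by (simp add: R_transform_def)
  then have "fps_inv (cauchy_series M) = fps_inv (cauchy_series L)"
    by (simp add: K_series_def)
  then have "fps_inv (fps_inv (cauchy_series M)) = fps_inv (fps_inv (cauchy_series L))"
    by (rule arg_cong)
  moreover have "prob_space M" "prob_space L"
    using assms(1,2) by (auto simp: compactly_supported_prob_def)
  ultimately show "cauchy_series M = cauchy_series L"
    by (simp only: *)
qed

text \<open>Weak convergence concerns bounded functions only. A continuous function that vanishes exactly on
\<open>[-B, B]\<close> detects mass outside the interval, and the powers may be truncated there because no mass
lies outside.\<close>
lemma weak_limit_bounded_support:
  assumes \<mu>: "\<And>i. real_distribution (\<mu> i)" "\<And>i. AE x in \<mu> i. \<bar>x\<bar> \<le> B"
    and M: "real_distribution M" and conv: "weak_conv_m \<mu> M"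
  shows "AE x in M. \<bar>x\<bar> \<le> B" "\<And>k. (\<lambda>i. LINT x|\<mu> i. x ^ k) \<longlonglongrightarrow> (LINT x|M. x ^ k)"
proof -
  interpret M: real_distribution M by fact
  interpret \<mu>: real_distribution "\<mu> i" for i by (rule \<mu>)
  let ?g = "\<lambda>x. min 1 (max 0 (\<bar>x\<bar> - B))"
  have "(\<lambda>i. integral\<^sup>L (\<mu> i) ?g) \<longlonglongrightarrow> integral\<^sup>L M ?g"
    by (rule weak_conv_imp_integral_bdd_continuous_conv[OF \<mu>(1) M conv, where B = 1])
      (auto intro!: continuous_intros)
  moreover have "integral\<^sup>L (\<mu> i) ?g = 0" for i
    by (rule integral_eq_zero_AE) (use \<mu>(2)[of i] in eventually_elim, simp)
  ultimately have "integral\<^sup>L M ?g = 0"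
    by (simp add: LIMSEQ_const_iff)
  moreover have "integrable M ?g"
    by (rule M.integrable_const_bound[where B = 1]) auto
  ultimately have "AE x in M. ?g x = 0"
    by (subst (asm) integral_nonneg_eq_0_iff_AE) auto
  then show AE: "AE x in M. \<bar>x\<bar> \<le> B"
    by eventually_elim (auto simp: min_def max_def split: if_splits)
  fix k
  let ?h = "\<lambda>x. (max (- \<bar>B\<bar>) (min \<bar>B\<bar> x)) ^ k"
  have "(\<lambda>i. integral\<^sup>L (\<mu> i) ?h) \<longlonglongrightarrow> integral\<^sup>L M ?h"
  proof (rule weak_conv_imp_integral_bdd_continuous_conv[OF \<mu>(1) M conv, where B = "\<bar>B\<bar> ^ k"])
    show "norm (?h x) \<le> \<bar>B\<bar> ^ k" for x
      unfolding norm_power by (intro power_mono) auto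
  qed (auto intro!: continuous_intros)
  moreover have "integral\<^sup>L P ?h = (LINT x|P. x ^ k)" if "real_distribution P" "AE x in P. \<bar>x\<bar> \<le> B" for P
  proof (rule integral_cong_AE)
    interpret P: real_distribution P by fact
    show "?h \<in> borel_measurable P" "(\<lambda>x. x ^ k) \<in> borel_measurable P" by measurable
    show "AE x in P. ?h x = x ^ k"
      using that(2)
    proof eventually_elim
      case (elim x)
      then have "max (- \<bar>B\<bar>) (min \<bar>B\<bar> x) = x" by (simp add: min_absorb2)
      then show ?case by simp
    qed
  qed
  ultimately show "(\<lambda>i. LINT x|\<mu> i. x ^ k) \<longlonglongrightarrow> (LINT x|M. x ^ k)"
    using \<mu> M AE by simp
qed

lemma tight_bounded_support:
  assumes \<mu>: "\<And>i. real_distribution (\<mu> i)" "\<And>i. AE x in \<mu> i. \<bar>x\<bar> \<le> B"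
  shows "tight \<mu>"
  unfolding tight_def
proof (intro conjI allI impI \<mu>(1))
  fix e :: real assume "0 < e"
  have "measure (\<mu> i) {- \<bar>B\<bar> - 1<..\<bar>B\<bar>} = 1" for i
  proof -
    interpret real_distribution "\<mu> i" by (rule \<mu>)
    have "AE x in \<mu> i. x \<in> {- \<bar>B\<bar> - 1<..\<bar>B\<bar>}"
      using \<mu>(2)[of i] by eventually_elim auto
    then show ?thesis
      by (subst prob_eq_1) auto
  qed
  then show "\<exists>a b. a < b \<and> (\<forall>i. 1 - e < measure (\<mu> i) {a<..b})"
    using \<open>0 < e\<close> by (intro exI[of _ "- \<bar>B\<bar> - 1"] exI[of _ "\<bar>B\<bar>"]) auto
qed

section \<open>Identification of the limit\<close>

lemma weighted_diracs:
  assumes q: "\<And>j. j < r \<Longrightarrow> 0 \<le> q j" "(\<Sum>j<r. q j) = 1"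
  shows "prob_space (weighted_diracs r q a)"
    and "cauchy_series (weighted_diracs r q a)
       = (\<Sum>j<r. fps_const (q j) * (fps_X * Abs_fps (\<lambda>k. a j ^ k)))"
proof -
  have meas: "a \<in> measurable (point_measure {..<r} (\<lambda>j. ennreal (q j))) borel"
    by (simp add: measurable_point_measure_eq1)
  have "prob_space (point_measure {..<r} (\<lambda>j. ennreal (q j)))"
  proof (rule prob_space_point_measure)
    show "(\<Sum>j<r. ennreal (q j)) = 1"
      using q by (subst sum_ennreal) auto
  qed auto
  then show "prob_space (weighted_diracs r q a)"
    unfolding weighted_diracs_def using meas by (rule prob_space.prob_space_distr)
  have "(LINT x|weighted_diracs r q a. x ^ k) = (\<Sum>j<r. q j * a j ^ k)" for k
  proof -
    have "(LINT x|weighted_diracs r q a. x ^ k) = (LINT j|point_measure {..<r} (\<lambda>j. ennreal (q j)). a j ^ k)"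
      unfolding weighted_diracs_def using meas by (intro integral_distr) simp_all
    also have "\<dots> = (\<Sum>j<r. q j *\<^sub>R a j ^ k)"
      using q(1) by (intro lebesgue_integral_point_measure_finite) auto
    finally show ?thesis by simp
  qed
  then show "cauchy_series (weighted_diracs r q a)
       = (\<Sum>j<r. fps_const (q j) * (fps_X * Abs_fps (\<lambda>k. a j ^ k)))"
    by (intro fps_ext) (simp add: cauchy_series_def fps_sum_nth)
qed

lemma inverse_shift:
  fixes i j x :: "'a::field"
  assumes "j * (1 - x * i) = i" "i \<noteq> 0"
  shows "inverse i = x + inverse j"
proof -
  have "j \<noteq> 0" using assms by auto
  then show ?thesis using assms by (simp add: field_simps)
qed

text \<open>The relation \<open>G\<^sub>M(z) = G\<^sub>L(z - G\<^sub>M(z))\<close> expresses in Cauchy transforms that the R-transforms differ by the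
identity function.\<close>
lemma R_transform_subordinate:
  assumes "prob_space M" "prob_space L"
    and sub: "cauchy_series M = cauchy_series L oo (fps_X * inverse (1 - fps_X * cauchy_series M))"
  shows "R_transform M = fls_X + R_transform L"
proof -
  let ?I = "\<lambda>M. fps_inv (cauchy_series M)"
  have c: "cauchy_series P $ 0 = 0" "cauchy_series P $ 1 = 1" if "prob_space P" for P
    using that by (simp_all add: cauchy_series_def prob_space.prob_space)
  have eq: "?I L * (1 - fps_X * ?I M) = ?I M"
    by (rule fps_inv_subordinate) (use c[OF assms(1)] c[OF assms(2)] sub in simp_all)
  have "?I M \<noteq> 0"
  proof
    assume "?I M = 0"
    then have "cauchy_series M oo 0 = fps_X"
      using fps_inv_right[of "cauchy_series M"] c[OF assms(1)] by simp
    then have "fps_nth (cauchy_series M oo 0) 1 = 1" by simp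
    then show False by (simp add: fps_compose_nth)
  qed
  moreover have "fps_to_fls (?I L) * (1 - fls_X * fps_to_fls (?I M)) = fps_to_fls (?I M)"
    using arg_cong[OF eq, of fps_to_fls]
    by (simp only: fls_times_fps_to_fls fps_to_fls_minus fps_one_to_fls fps_X_to_fls)
  ultimately have "inverse (fps_to_fls (?I M)) = fls_X + inverse (fps_to_fls (?I L))"
    by (intro inverse_shift) simp_all
  then show ?thesis by (simp add: R_transform_def K_series_def)
qed

lemma pcompose_multiple_hermite:
  assumes "inj_on a {..<r}" "0 < N"
  shows "\<exists>c\<noteq>0. pcompose (multiple_hermite r m (\<lambda>j. sqrt (real N) * a j)) [:0, sqrt (real N):]
     = smult c (heat (- 1 / real N) (\<Prod>j<r. [:- a j, 1:] ^ m j))"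
proof -
  define s where "s = sqrt (real N)"
  have s: "s \<noteq> 0" "s\<^sup>2 = real N" using assms(2) by (simp_all add: s_def)
  have inj: "inj_on (\<lambda>j. s * a j) {..<r}"
    using assms(1) s(1) by (auto simp: inj_on_def)
  have pow: "pcompose (p ^ k) t = (pcompose p t) ^ k" for p t :: "real poly" and k
    by (induction k) (simp_all add: pcompose_mult pcompose_1)
  have "pcompose [:- (s * a j), 1:] [:0, s:] = smult s [:- a j, 1:]" for j
    by (simp add: pcompose_pCons)
  then have "pcompose (\<Prod>j<r. [:- (s * a j), 1:] ^ m j) [:0, s:]
      = (\<Prod>j<r. smult (s ^ m j) ([:- a j, 1:] ^ m j))"
    by (simp only: pcompose_prod pow smult_power)
  also have "\<dots> = smult (\<Prod>j<r. s ^ m j) (\<Prod>j<r. [:- a j, 1:] ^ m j)"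
    by (rule prod_smult)
  finally have "heat (- 1 / real N) (pcompose (\<Prod>j<r. [:- (s * a j), 1:] ^ m j) [:0, s:])
      = smult (\<Prod>j<r. s ^ m j) (heat (- 1 / real N) (\<Prod>j<r. [:- a j, 1:] ^ m j))"
    by (simp only: heat_smult)
  moreover have "- 1 / real N * s\<^sup>2 = - 1" using s(2) assms(2) by simp
  then have "heat (- 1 / real N) (pcompose p [:0, s:]) = pcompose (heat (- 1) p) [:0, s:]" for p
    by (simp only: heat_pcompose_affine)
  ultimately have "pcompose (multiple_hermite r m (\<lambda>j. s * a j)) [:0, s:]
     = smult (\<Prod>j<r. s ^ m j) (heat (- 1 / real N) (\<Prod>j<r. [:- a j, 1:] ^ m j))"
    by (simp only: multiple_hermite_eq_heat[OF inj])
  moreover have "(\<Prod>j<r. s ^ m j) \<noteq> 0" using s(1) by simp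
  ultimately show ?thesis unfolding s_def by blast
qed

lemma prod_linear_power_eq_root_poly:
  "finite A \<Longrightarrow> \<exists>Y. (\<Prod>j\<in>A. [:- a j, 1:] ^ m j) = root_poly Y \<and> set_mset Y \<subseteq> a ` A"
proof (induction A rule: finite_induct)
  case empty
  then show ?case by (intro exI[of _ "{#}"]) simp
next
  case (insert j A)
  then obtain Y where Y: "(\<Prod>j\<in>A. [:- a j, 1:] ^ m j) = root_poly Y" "set_mset Y \<subseteq> a ` A" by blast
  have "(\<Prod>j\<in>insert j A. [:- a j, 1:] ^ m j) = root_poly (replicate_mset (m j) (a j) + Y)"
    using insert.hyps by (simp add: Y(1) prod_mset.distrib[symmetric] del: mult_pCons_left)
  moreover have "set_mset (replicate_mset (m j) (a j) + Y) \<subseteq> a ` insert j A"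
    using Y(2) by (auto split: if_splits)
  ultimately show ?case by blast
qed

lemma integral_zero_distribution_real_rooted:
  assumes "c \<noteq> 0" "Z \<noteq> {#}" and f: "continuous_on UNIV f"
  shows "integral\<^sup>L (zero_distribution (map_poly complex_of_real (smult c (root_poly Z)))) f
     = integral\<^sup>L (empirical Z) (\<lambda>x. f (complex_of_real x) :: real)"
proof -
  have "proots (map_poly complex_of_real (smult c (root_poly Z))) = image_mset of_real Z"
    unfolding map_poly_of_real_smult using assms(1) by (subst proots_smult) (auto simp: proots_map_of_real_root_poly)
  moreover have "f \<in> borel_measurable borel" using f by (rule borel_measurable_continuous_onI)
  moreover have "(\<lambda>x. f (complex_of_real x)) \<in> borel_measurable borel"
    by (intro borel_measurable_continuous_onI continuous_on_compose2[OF f] continuous_intros) auto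
  ultimately show ?thesis
    using assms(2) by (simp add: zero_distribution_def integral_distr integral_pmf_of_multiset integral_empirical
      image_mset.compositionality o_def)
qed

text \<open>Every weak limit point of the zero distributions has the R-transform required of the free
convolution. The multiplicities \<open>m i j\<close> and degrees \<open>d i\<close> are those of a subsequence.\<close>
lemma weak_limit_R_transform:
  fixes a q :: "nat \<Rightarrow> real" and m :: "nat \<Rightarrow> nat \<Rightarrow> nat" and d :: "nat \<Rightarrow> nat"
  assumes d: "\<And>i. 0 < d i" "(\<lambda>i. 1 / real (d i)) \<longlonglongrightarrow> 0"
    and Z: "\<And>i. heat (- 1 / real (d i)) (\<Prod>j<r. [:- a j, 1:] ^ m i j) = root_poly (Z i)"
      "\<And>i. size (Z i) = d i" "\<And>i x. x \<in># Z i \<Longrightarrow> \<bar>x\<bar> \<le> B"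
    and m: "\<And>j. j < r \<Longrightarrow> (\<lambda>i. real (m i j) / real (d i)) \<longlonglongrightarrow> q j"
    and q: "\<And>j. j < r \<Longrightarrow> 0 \<le> q j" "(\<Sum>j<r. q j) = 1"
    and M: "real_distribution M" "weak_conv_m (\<lambda>i. empirical (Z i)) M"
  shows "compactly_supported_prob M \<and> R_transform M = R_transform semicircle + R_transform (weighted_diracs r q a)"
proof -
  interpret M: real_distribution M by fact
  have ne: "Z i \<noteq> {#}" for i
    using Z(2)[of i] d(1)[of i] by auto
  have AE: "AE x in empirical (Z i). \<bar>x\<bar> \<le> B" for i
    using ne Z(3) by (rule AE_empirical)
  note lim = weak_limit_bounded_support[OF real_distribution_empirical AE M]
  have "fps_tendsto (\<lambda>i. moment_series (Z i)) (cauchy_series M)"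
    unfolding fps_tendsto_def
  proof
    fix k
    show "(\<lambda>i. fps_nth (moment_series (Z i)) k) \<longlonglongrightarrow> fps_nth (cauchy_series M) k"
      using lim(2)[of "k - 1"] unfolding cauchy_series_empirical[OF ne, symmetric]
      by (cases k) (simp_all add: cauchy_series_def)
  qed
  then interpret heat_zeros d "\<lambda>i. \<Prod>j<r. [:- a j, 1:] ^ m i j" Z "cauchy_series M"
    by unfold_locales (use d Z in auto)
  have "cauchy_series M = cauchy_series (weighted_diracs r q a) oo (fps_X * inverse (1 - fps_X * cauchy_series M))"
  proof -
    have "(\<Prod>j<r. 1 - fps_const (a j) * fps_X - fps_X * cauchy_series M) * cauchy_series M
        = (\<Sum>j<r. fps_const (q j) * (fps_X * (\<Prod>i\<in>{..<r} - {j}. 1 - fps_const (a i) * fps_X - fps_X * cauchy_series M)))"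
      by (rule moment_series_equation[OF finite_lessThan refl]) (use m in simp)
    from subordination[OF finite_lessThan this] show ?thesis
      by (simp only: weighted_diracs(2)[OF q])
  qed
  then have "R_transform M = fls_X + R_transform (weighted_diracs r q a)"
    by (intro R_transform_subordinate M.prob_space_axioms weighted_diracs(1)[OF q])
  then show ?thesis
    unfolding compactly_supported_prob_iff R_transform_semicircle using M(1) lim(1) by blast
qed

theorem theorem3p5:
  fixes r :: nat and a q :: "nat \<Rightarrow> real" and n :: "nat \<Rightarrow> nat \<Rightarrow> nat"
    and H :: "nat \<Rightarrow> real poly" and \<nu> :: "nat \<Rightarrow> complex measure"
  assumes "r \<ge> 2"
    and "inj_on a {..<r}"
    and "path_like r n q"
  defines "\<And>N. H N \<equiv> multiple_hermite r (n N) (\<lambda>j. sqrt (real N) * a j)"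
    and "\<And>N. \<nu> N \<equiv> zero_distribution
           (map_poly complex_of_real (pcompose (H N) [:0, sqrt (real N):]))"
  shows "converges_weakly \<nu>
           (distr (semicircle \<boxplus> weighted_diracs r q a) borel complex_of_real)"
proof -
  have n_sum: "(\<Sum>j<r. n N j) = N" for N
    using assms(3) by (simp add: path_like_def)
  have q_pos: "0 \<le> q j" and n_lim: "(\<lambda>N. real (n N j) / real N) \<longlonglongrightarrow> q j" if "j < r" for j
    using assms(3) that by (auto simp: path_like_def intro: less_imp_le)
  have q_sum: "(\<Sum>j<r. q j) = 1"
  proof (rule LIMSEQ_unique)
    show "(\<lambda>N. \<Sum>j<r. real (n (Suc N) j) / real (Suc N)) \<longlonglongrightarrow> (\<Sum>j<r. q j)"
      by (intro tendsto_sum LIMSEQ_Suc[OF n_lim]) auto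
    have "(\<Sum>j<r. real (n (Suc N) j) / real (Suc N)) = 1" for N
      using n_sum[of "Suc N"] by (simp add: sum_divide_distrib[symmetric] flip: of_nat_sum)
    then show "(\<lambda>N. \<Sum>j<r. real (n (Suc N) j) / real (Suc N)) \<longlonglongrightarrow> 1"
      by simp
  qed
  obtain A where A: "\<And>j. j < r \<Longrightarrow> \<bar>a j\<bar> \<le> A"
    using finite_imp_bounded[of "a ` {..<r}"] by (auto simp: bounded_iff)
  have "\<exists>Z. heat (- 1 / real (Suc N)) (\<Prod>j<r. [:- a j, 1:] ^ n (Suc N) j) = root_poly Z
      \<and> size Z = Suc N \<and> (\<forall>x\<in>#Z. \<bar>x\<bar> \<le> A + 2)" for N
  proof -
    obtain Y where Y: "(\<Prod>j<r. [:- a j, 1:] ^ n (Suc N) j) = root_poly Y" "set_mset Y \<subseteq> a ` {..<r}"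
      using prod_linear_power_eq_root_poly[of "{..<r}"] by blast
    have "degree (\<Prod>j<r. [:- a j, 1:] ^ n (Suc N) j) = Suc N"
      using n_sum[of "Suc N"] by (subst degree_prod_eq_sum_degree) (auto simp: degree_power_eq)
    then have "size Y = Suc N"
      using monic_root_poly[of Y] by (simp only: Y(1))
    moreover have "\<bar>y\<bar> \<le> A" if "y \<in># Y" for y
      using that Y(2) A by auto
    ultimately show ?thesis
      unfolding Y(1) by (metis heat_root_poly zero_less_Suc)
  qed
  then obtain Z where Z: "\<And>N. heat (- 1 / real (Suc N)) (\<Prod>j<r. [:- a j, 1:] ^ n (Suc N) j) = root_poly (Z N)"
      "\<And>N. size (Z N) = Suc N" "\<And>N x. x \<in># Z N \<Longrightarrow> \<bar>x\<bar> \<le> A + 2"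
    by metis
  \<comment> \<open>The degree 0 has no zeros, so the sequence starts at degree 1: \<open>\<mu> N\<close> belongs to the degree \<open>N + 1\<close>.\<close>
  define \<mu> where "\<mu> N = empirical (Z N)" for N
  have ne: "Z N \<noteq> {#}" for N using Z(2)[of N] by auto
  have \<mu>: "real_distribution (\<mu> N)" "AE x in \<mu> N. \<bar>x\<bar> \<le> A + 2" for N
    unfolding \<mu>_def using ne Z(3) by (auto intro: real_distribution_empirical AE_empirical)
  have tight: "tight \<mu>"
    using \<mu> by (rule tight_bounded_support)
  let ?R = "R_transform semicircle + R_transform (weighted_diracs r q a)"
  have limit: "compactly_supported_prob M \<and> R_transform M = ?R"
    if s: "strict_mono s" and M: "real_distribution M" "weak_conv_m (\<mu> \<circ> s) M" for s M
  proof (rule weak_limit_R_transform[where Z = "\<lambda>i. Z (s i)" and m = "\<lambda>i. n (Suc (s i))" and d = "\<lambda>i. Suc (s i)"])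
    have Suc_s: "filterlim (\<lambda>i. Suc (s i)) sequentially sequentially"
      using filterlim_compose[OF filterlim_Suc filterlim_subseq[OF s]] by simp
    show "(\<lambda>i. 1 / real (Suc (s i))) \<longlonglongrightarrow> 0"
      using filterlim_compose[OF lim_1_over_n Suc_s] by simp
    show "(\<lambda>i. real (n (Suc (s i)) j) / real (Suc (s i))) \<longlonglongrightarrow> q j" if "j < r" for j
      using filterlim_compose[OF n_lim[OF that] Suc_s] .
    show "weak_conv_m (\<lambda>i. empirical (Z (s i))) M"
      using M(2) by (simp add: \<mu>_def[abs_def] o_def)
  qed (use Z q_pos q_sum M in auto)
  \<comment> \<open>a limit point exists by tightness; it witnesses the existence of the free convolution\<close>
  obtain s P where s: "strict_mono s" and P: "real_distribution P" "weak_conv_m (\<mu> \<circ> id \<circ> s) P"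
    using tight_imp_convergent_subsubsequence[OF tight strict_mono_id] by blast
  have P_R: "compactly_supported_prob P \<and> R_transform P = ?R"
    using limit[OF s P(1)] P(2) by simp
  have unique: "L = P" if "compactly_supported_prob L \<and> R_transform L = ?R" for L
    using R_transform_inj that P_R by metis
  have conv: "semicircle \<boxplus> weighted_diracs r q a = P"
    unfolding free_convolution_def using P_R unique by (rule the_equality)
  have weak: "weak_conv_m \<mu> P"
  proof (rule tight_subseq_weak_converge[OF \<mu>(1) P(1) tight])
    fix s L assume "strict_mono s" "real_distribution L" "weak_conv_m (\<mu> \<circ> s) L"
    then show "weak_conv_m (\<mu> \<circ> s) P" using unique[OF limit] by simp
  qed
  interpret P: real_distribution P by (rule P(1))
  show ?thesis
    unfolding converges_weakly_def conv
  proof (intro allI impI)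
    fix f :: "complex \<Rightarrow> real" assume f: "continuous_on UNIV f \<and> bounded (range f)"
    then obtain B where B: "\<And>z. norm (f z) \<le> B" by (auto simp: bounded_iff)
    have isCont: "isCont (\<lambda>x. f (complex_of_real x)) x" for x
    proof -
      have "continuous_on UNIV (\<lambda>x. f (complex_of_real x))"
        by (rule continuous_on_compose2[OF conjunct1[OF f] continuous_on_of_real[OF continuous_on_id]]) simp
      then show ?thesis by (simp add: continuous_on_eq_continuous_at)
    qed
    have "(\<lambda>N. integral\<^sup>L (\<mu> N) (\<lambda>x. f (complex_of_real x))) \<longlonglongrightarrow> integral\<^sup>L P (\<lambda>x. f (complex_of_real x))"
      by (rule weak_conv_imp_integral_bdd_continuous_conv[OF \<mu>(1) P(1) weak isCont B])
    moreover have "integral\<^sup>L (\<mu> N) (\<lambda>x. f (complex_of_real x)) = integral\<^sup>L (\<nu> (Suc N)) f" for N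
    proof -
      obtain c where "c \<noteq> 0" "pcompose (H (Suc N)) [:0, sqrt (real (Suc N)):] = smult c (root_poly (Z N))"
        using pcompose_multiple_hermite[OF assms(2), of "Suc N" "n (Suc N)"] unfolding assms(4) Z(1) by blast
      then show ?thesis
        unfolding \<mu>_def assms(5)
        using integral_zero_distribution_real_rooted[OF \<open>c \<noteq> 0\<close> ne conjunct1[OF f], of N] by (simp only:)
    qed
    moreover have "integral\<^sup>L (distr P borel complex_of_real) f = integral\<^sup>L P (\<lambda>x. f (complex_of_real x))"
      using f by (intro integral_distr) (auto intro: borel_measurable_continuous_onI)
    ultimately show "(\<lambda>N. integral\<^sup>L (\<nu> N) f) \<longlonglongrightarrow> integral\<^sup>L (distr P borel complex_of_real) f"
      by (intro LIMSEQ_imp_Suc[of "\<lambda>N. integral\<^sup>L (\<nu> N) f"]) (simp only:)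
  qed
qed

end
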